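(* Let $D=C_n^S$ be a cycle digraph. The Laplacian simplex $P_{C_n^S}$ associated to $C_n^S$ is reflexive if and only if one of the following conditions is satisfied: 1. $S=\varnothing$, or 2. $S=[n]$ and $n=2$, or 3. $S=[n]$ and $n$ is odd, or 4. $\varnothing\subsetneq S\subsetneq[n]$, and $k\mid c(D)$ for each integer $1\le k\le K+1$, where $K$ is the length of the longest chain of consecutive edges pointing counterclockwise, i.e. $$K=\max\{\,j \mid \{a+1,\ldots,a+j\}\subseteq S\text{ for some }a\in[n]\,\},$$ where, since $S\subsetneq[n]$, the vertices are assumed (without loss of generality, by a cyclic relabeling) to be labeled so that $1\notin S$.
   Context: For $n\ge 3$ and $S\subseteq[n]=\{1,\ldots,n\}$, the cycle digraph $C_n^S$ is the simple digraph on the vertex set $[n]$ whose set of directed edges $(\text{tail},\text{head})$ is $\overrightarrow{E}\cup\overleftarrow{E}$, where $$\overrightarrow{E}=\{(1,2),(2,3),\ldots,(n-1,n),(n,1)\},\qquad \overleftarrow{E}=\{(i,i-1): i\in S\},$$ with the convention that $(1,0)$ means $(1,n)$. The edges in $\overleftarrow{E}$ are those pointing counterclockwise. For a digraph $D$ on $[n]$ let $a_{i,j}$ be the number of directed edges from $i$ (tail) to $j$ (head), and $\mathrm{outdeg}(i)=\sum_j a_{i,j}$. The Laplacian matrix of $D$ is $L(D)=O(D)-A(D)$, where $A(D)=(a_{i,j})$ and $O(D)$ is the diagonal matrix with entries $\mathrm{outdeg}(i)$. The Laplacian polytope of $D$ is $P_D=\operatorname{conv}\{\mathbf{v}_1,\ldots,\mathbf{v}_n\}\subset\mathbb{R}^n$,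 where $\mathbf{v}_i$ is the $i$-th row of $L(D)$. It lies in the hyperplane $H=\{\mathbf{x}\in\mathbb{R}^n:\sum_i x_i=0\}$ and is regarded as a lattice polytope with respect to $H\cap\mathbb{Z}^n$; deleting any one column of $L(D)$ and taking the convex hull of the rows gives a unimodularly equivalent copy of $P_D$ in $\mathbb{R}^{n-1}$ with lattice $\mathbb{Z}^{n-1}$. For a cycle digraph $P_D$ is an $(n-1)$-dimensional simplex, called the Laplacian simplex. A converging tree is a digraph whose underlying undirected graph is connected and that has one vertex of outdegree zero (its root), all other vertices having outdegree one. The complexity $c(D)$ is the total number of converging trees that are spanning subgraphs of $D$ (i.e. have vertex set $[n]$), over all possible roots. A full-dimensional lattice polytope $P\subset\mathbb{R}^d$ containing the origin in its interior is reflexive if its dual $P^*=\{\mathbf{x}\in\mathbb{R}^d:\mathbf{x}\cdot\mathbf{y}\le 1\text{ for all }\mathbf{y}\in P\}$ is again a lattice polytope (vertices in $\mathbb{Z}^d$). Every lattice polytope unimodularly equivalent (via an affine isomorphism of lattices) to such a $P$ is also called reflexive. *)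

theory Defs
  imports "HOL-Analysis.Analysis" "Graph_Theory.Graph_Theory"
begin

section \<open>Cycle digraphs and complexity\<close>

text \<open>The arc \<open>(i, i - 1)\<close> for \<open>i = 1\<close> is read as \<open>(1, n)\<close>. Arcs form a set of pairs, so the
  digraph is simple.\<close>

definition cycle_digraph :: "nat \<Rightarrow> nat set \<Rightarrow> nat pair_pre_digraph" where
  "cycle_digraph n S =
     \<lparr> pverts = {1..n},
       parcs = {(i, i + 1) |i. 1 \<le> i \<and> i < n} \<union> {(n, 1)}
             \<union> {(i, if i = 1 then n else i - 1) |i. i \<in> S} \<rparr>"

text \<open>\<open>connected\<close> on digraphs is strong connectedness of the symmetric closure, that is,
  connectedness of the underlying undirected graph.\<close>

definition converging_tree :: "('a, 'b) pre_digraph \<Rightarrow> bool" where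
  "converging_tree T \<longleftrightarrow>
     Digraph_Component.connected T \<and>
     (\<exists>r \<in> verts T. out_degree T r = 0 \<and> (\<forall>v \<in> verts T - {r}. out_degree T v = 1))"

definition complexity :: "('a, 'b) pre_digraph \<Rightarrow> nat" where
  "complexity D = card {T. spanning T D \<and> converging_tree T}"

text \<open>The cyclic relabeling that moves every vertex \<open>r\<close> steps forward on \<open>{1..n}\<close>.\<close>

definition cyclic_relabel :: "nat \<Rightarrow> nat \<Rightarrow> nat set \<Rightarrow> nat set" where
  "cyclic_relabel n r S = (\<lambda>i. (i - 1 + r) mod n + 1) ` S"

text \<open>The intervals below do not wrap around from \<open>n\<close> to \<open>1\<close>, so this is meant for \<open>S\<close> with
  \<open>1 \<notin> S\<close>; otherwise a cyclic chain passing through \<open>1\<close> may be cut.\<close>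

definition longest_ccw_chain :: "nat \<Rightarrow> nat set \<Rightarrow> nat" where
  "longest_ccw_chain n S = Max {j. \<exists>a \<in> {1..n}. {a + 1..a + j} \<subseteq> S}"

section \<open>Laplacian polytopes\<close>

definition adjacency :: "('a, 'b) pre_digraph \<Rightarrow> 'a \<Rightarrow> 'a \<Rightarrow> nat" where
  "adjacency D i j = card {e \<in> arcs D. tail D e = i \<and> head D e = j}"

definition laplacian :: "('a, 'b) pre_digraph \<Rightarrow> 'a \<Rightarrow> 'a \<Rightarrow> int" where
  "laplacian D i j = (if i = j then int (out_degree D i) else 0) - int (adjacency D i j)"

text \<open>The map \<open>lab\<close> numbers the coordinates of \<open>real ^ 'n\<close> by the vertices of \<open>D\<close>; it is meant to
  be a bijection from \<open>'n\<close> onto \<open>verts D\<close>.\<close>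

definition laplacian_polytope ::
  "('n::finite \<Rightarrow> 'a) \<Rightarrow> ('a, 'b) pre_digraph \<Rightarrow> (real ^ 'n) set" where
  "laplacian_polytope lab D =
     convex hull ((\<lambda>i. \<chi> j. of_int (laplacian D i (lab j))) ` verts D)"

definition zero_sum_hyperplane :: "(real ^ 'n::finite) set" where
  "zero_sum_hyperplane = {x. (\<Sum>i\<in>UNIV. x $ i) = 0}"

section \<open>Reflexive polytopes\<close>

definition integer_lattice :: "(real ^ 'n::finite) set" where
  "integer_lattice = {x. \<forall>i. x $ i \<in> \<int>}"

definition lattice_polytope :: "(real ^ 'n::finite) set \<Rightarrow> bool" where
  "lattice_polytope P \<longleftrightarrow> polytope P \<and> (\<forall>v. v extreme_point_of P \<longrightarrow> v \<in> integer_lattice)"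

definition dual_polytope :: "(real ^ 'n::finite) set \<Rightarrow> (real ^ 'n) set" where
  "dual_polytope P = {x. \<forall>y \<in> P. x \<bullet> y \<le> 1}"

text \<open>Since \<open>interior\<close> is the topological interior, \<open>0 \<in> interior P\<close> forces \<open>P\<close> to be
  full-dimensional.\<close>

definition origin_reflexive :: "(real ^ 'd::finite) set \<Rightarrow> bool" where
  "origin_reflexive P \<longleftrightarrow>
     lattice_polytope P \<and> 0 \<in> interior P \<and> lattice_polytope (dual_polytope P)"

text \<open>Equivalence of \<open>P \<subseteq> V\<close> and \<open>Q \<subseteq> W\<close> for affine subspaces \<open>V\<close>, \<open>W\<close> carrying the lattices of
  their integer points: an affine bijection from \<open>V\<close> to \<open>W\<close>, written as the restriction of an
  affine map of the ambient spaces, which maps lattice onto lattice and \<open>P\<close> onto \<open>Q\<close>.\<close>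

definition unimodularly_equivalent ::
  "(real ^ 'n::finite) set \<Rightarrow> (real ^ 'n) set \<Rightarrow> (real ^ 'd::finite) set \<Rightarrow> (real ^ 'd) set \<Rightarrow> bool"
where
  "unimodularly_equivalent V P W Q \<longleftrightarrow>
     (\<exists>h c. linear h \<and>
        bij_betw (\<lambda>x. h x + c) V W \<and>
        (\<lambda>x. h x + c) ` (V \<inter> integer_lattice) = W \<inter> integer_lattice \<and>
        (\<lambda>x. h x + c) ` P = Q)"

text \<open>Reflexivity of \<open>P \<subseteq> V\<close> with respect to the lattice of integer points of \<open>V\<close>. The type
  argument is the index type of the model space; an equivalence can only exist if \<open>V\<close> has
  dimension \<open>CARD('d)\<close>.\<close>

definition reflexive_in ::
  "'d::finite itself \<Rightarrow> (real ^ 'n::finite) set \<Rightarrow> (real ^ 'n) set \<Rightarrow> bool" where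
  "reflexive_in d V P \<longleftrightarrow>
     (\<exists>Q :: (real ^ 'd) set. origin_reflexive Q \<and> unimodularly_equivalent V P UNIV Q)"

end

theory Submission
  imports Defs
begin

text \<open>The origin is an interior lattice point of the Laplacian simplex, and a reflexive polytope has
  only one such point; so the simplex is reflexive iff the functionals that equal 1 on its facets
  are integral on the lattice of the hyperplane. Such a functional is a function on the vertices of
  the cycle, taken modulo constants, and its differences \<open>d j\<close> along the cycle satisfy
  \<open>d j - s j d (j - 1) = 1\<close> at all vertices but one, where \<open>s\<close> is the indicator of \<open>S\<close>. If \<open>S\<close> is
  everything, the \<open>d j\<close> form an arithmetic progression of sum zero, which is integral iff \<open>n\<close> is
  odd. Otherwise they are integral for the exceptional vertex \<open>i\<close> iff \<open>w i\<close> divides the sum of all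
  weights \<open>w\<close>, where \<open>w i - 1\<close> is the length of the run of \<open>S\<close> following \<open>i\<close>. A spanning converging
  tree with root \<open>i\<close> is determined by how far into this run its arcs point counterclockwise, so
  this sum is the complexity; and the values of \<open>w\<close> are exactly \<open>1, \<dots>, K + 1\<close>.\<close>

section \<open>Simplices and their duals\<close>

text \<open>Pairing an affine relation with \<open>u i\<close> removes the constant 1, because the
  coefficients sum to 0, and leaves only \<open>- b i * g i\<close>. The hypothesis is symmetric in
  \<open>u\<close> and \<open>v\<close>, so the lemma serves the simplex and its dual alike.\<close>

lemma biorthogonal_affine_independent:
  fixes v u :: "'i \<Rightarrow> 'a::euclidean_space" and g :: "'i \<Rightarrow> real"
  assumes fin: "finite I" and g: "\<And>i. i \<in> I \<Longrightarrow> g i \<noteq> 0"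
    and uv: "\<And>i j. i \<in> I \<Longrightarrow> j \<in> I \<Longrightarrow> u i \<bullet> v j = 1 - (if i = j then g i else 0)"
  shows "inj_on v I" and "\<not> affine_dependent (v ` I)"
proof -
  show inj: "inj_on v I"
  proof (rule inj_onI)
    fix i j assume ij: "i \<in> I" "j \<in> I" "v i = v j"
    then have "u i \<bullet> v i = u i \<bullet> v j" by simp
    then show "i = j" using uv[of i i] uv[of i j] g[of i] ij by (auto split: if_splits)
  qed
  show "\<not> affine_dependent (v ` I)"
  proof
    assume "affine_dependent (v ` I)"
    then obtain a where a: "sum a (v ` I) = 0" "\<exists>x\<in>v ` I. a x \<noteq> 0" "(\<Sum>x\<in>v ` I. a x *\<^sub>R x) = 0"
      using fin by (auto simp: affine_dependent_explicit_finite)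
    define b where "b = a \<circ> v"
    have b: "sum b I = 0" "(\<Sum>j\<in>I. b j *\<^sub>R v j) = 0"
      using a inj by (simp_all add: sum.reindex b_def)
    have "b i = 0" if i: "i \<in> I" for i
    proof -
      have "0 = u i \<bullet> (\<Sum>j\<in>I. b j *\<^sub>R v j)" by (simp add: b)
      also have "\<dots> = (\<Sum>j\<in>I. b j - (if i = j then b j * g i else 0))"
        unfolding inner_sum_right using i by (intro sum.cong) (auto simp: uv algebra_simps)
      also have "\<dots> = - b i * g i" using i fin b by (simp add: sum_subtractf)
      finally show "b i = 0" using g[OF i] by simp
    qed
    then show False using a(2) by (auto simp: b_def)
  qed
qed

text \<open>For \<open>\<Sum> c\<^sub>i v\<^sub>i = 0\<close>, the functional equal to 1 on the facet opposite to \<open>v\<^sub>i\<close> must take the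
  value \<open>1 - (\<Sum> c) / c\<^sub>i\<close> at \<open>v\<^sub>i\<close>; hence the \<open>u\<^sub>i\<close> below are the vertices of the dual simplex.\<close>

locale simplex_with_dual =
  fixes I :: "'i set" and v u :: "'i \<Rightarrow> 'a::euclidean_space" and c :: "'i \<Rightarrow> real"
  assumes fin: "finite I" and card_gt: "DIM('a) < card I"
    and c_pos: "\<And>i. i \<in> I \<Longrightarrow> 0 < c i"
    and barycenter: "(\<Sum>i\<in>I. c i *\<^sub>R v i) = 0"
    and dual: "\<And>i j. i \<in> I \<Longrightarrow> j \<in> I \<Longrightarrow> u i \<bullet> v j = 1 - (if i = j then sum c I / c i else 0)"
begin

lemma I_ne: "I \<noteq> {}" using card_gt by auto

lemma total_pos: "0 < sum c I"
  using fin I_ne c_pos by (intro sum_pos) auto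

lemma ratio_ne: "i \<in> I \<Longrightarrow> sum c I / c i \<noteq> 0"
  using c_pos[of i] total_pos by auto

lemma v_indep: "inj_on v I" "\<not> affine_dependent (v ` I)"
  by (rule biorthogonal_affine_independent[OF fin ratio_ne dual]; assumption)+

lemma u_indep: "\<not> affine_dependent (u ` I)"
  by (rule biorthogonal_affine_independent(2)[OF fin ratio_ne, where u = v])
    (auto simp: dual inner_commute[of "v _"])

text \<open>Normalizing the positive relation \<open>barycenter\<close> writes the origin as a
  convex combination without vanishing coefficients; \<open>card_gt\<close> makes the simplex
  full-dimensional.\<close>

lemma zero_in_interior: "0 \<in> interior (convex hull (v ` I))"
proof -
  \<comment> \<open>The criterion for interior points takes coefficients indexed by points, so
    \<open>c\<close> is transferred along the injection \<open>v\<close>.\<close>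
  define b where "b = (\<lambda>x. c (the_inv_into I v x) / sum c I)"
  have b: "b (v i) = c i / sum c I" if "i \<in> I" for i
    using that v_indep(1) by (simp add: b_def the_inv_into_f_f)
  have "\<forall>x\<in>v ` I. 0 < b x" using b c_pos total_pos by auto
  moreover have "sum b (v ` I) = 1"
    using v_indep(1) b total_pos by (simp add: sum.reindex flip: sum_divide_distrib)
  moreover have "(\<Sum>x\<in>v ` I. b x *\<^sub>R x) = 0"
  proof -
    have "(\<Sum>x\<in>v ` I. b x *\<^sub>R x) = (\<Sum>i\<in>I. (1 / sum c I) *\<^sub>R (c i *\<^sub>R v i))"
      using v_indep(1) b by (simp add: sum.reindex)
    then show ?thesis using barycenter by (simp only: scaleR_right.sum [symmetric]) simp
  qed
  ultimately show ?thesis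
    using card_gt v_indep by (auto simp: interior_convex_hull_explicit_minimal card_image)
qed

text \<open>The simplex contains a ball around the origin, hence a positive multiple of a nonzero
  \<open>x\<close>, but it lies in the hyperplane orthogonal to \<open>x\<close>.\<close>

lemma eq_zeroI:
  assumes "\<And>i. i \<in> I \<Longrightarrow> x \<bullet> v i = 0" shows "x = 0"
proof (rule ccontr)
  assume x: "x \<noteq> 0"
  obtain e where e: "e > 0" "cball 0 e \<subseteq> convex hull (v ` I)"
    using zero_in_interior mem_interior_cball by blast
  have "(e / norm x) *\<^sub>R x \<in> convex hull (v ` I)" using e x by (intro subsetD[OF e(2)]) auto
  moreover have "convex hull (v ` I) \<subseteq> {y. x \<bullet> y = 0}"
    using assms by (intro hull_minimal) (auto simp: convex_hyperplane)
  ultimately show False using e x by auto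
qed

text \<open>One inclusion is checked on pairs of vertices. For the other, the slack of
  \<open>x\<close> at \<open>v i\<close>, suitably scaled, is its barycentric coordinate at
  \<open>u i\<close>.\<close>

lemma polar_eq: "{x. \<forall>y \<in> convex hull (v ` I). x \<bullet> y \<le> 1} = convex hull (u ` I)"
proof (intro equalityI subsetI)
  fix x assume "x \<in> {x. \<forall>y \<in> convex hull (v ` I). x \<bullet> y \<le> 1}"
  then have x: "x \<bullet> v i \<le> 1" if "i \<in> I" for i using that by (simp add: hull_inc)
  \<comment> \<open>Solved from \<open>1 - b j * (sum c I / c j) = x \<bullet> v j\<close>, the
    pairing of the sought combination with \<open>v j\<close>.\<close>
  define b where "b i = c i * (1 - x \<bullet> v i) / sum c I" for i
  have "(\<Sum>i\<in>I. c i * (x \<bullet> v i)) = x \<bullet> (\<Sum>i\<in>I. c i *\<^sub>R v i)" by (simp add: inner_sum_right)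
  then have b1: "sum b I = 1"
    using total_pos by (simp add: b_def right_diff_distrib sum_subtractf barycenter flip: sum_divide_distrib)
  have "x - (\<Sum>i\<in>I. b i *\<^sub>R u i) = 0"
  proof (rule eq_zeroI)
    fix j assume j: "j \<in> I"
    have "(\<Sum>i\<in>I. b i *\<^sub>R u i) \<bullet> v j = (\<Sum>i\<in>I. b i - (if i = j then b i * (sum c I / c i) else 0))"
      unfolding inner_sum_left using j by (intro sum.cong) (auto simp: dual algebra_simps)
    also have "\<dots> = 1 - b j * (sum c I / c j)" using j fin b1 by (simp add: sum_subtractf)
    also have "\<dots> = x \<bullet> v j" using c_pos[OF j] total_pos by (simp add: b_def)
    finally show "(x - (\<Sum>i\<in>I. b i *\<^sub>R u i)) \<bullet> v j = 0" by (simp add: inner_diff_left)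
  qed
  moreover have "(\<Sum>i\<in>I. b i *\<^sub>R u i) \<in> convex hull (u ` I)"
    using b1 fin x c_pos total_pos
    by (intro convex_sum) (auto simp: b_def hull_inc less_imp_le intro!: divide_nonneg_pos mult_nonneg_nonneg)
  ultimately show "x \<in> convex hull (u ` I)" by simp
next
  have uv: "u i \<bullet> v j \<le> 1" if "i \<in> I" "j \<in> I" for i j
    using that dual[of i j] c_pos[of i] total_pos by auto
  have "convex hull (v ` I) \<subseteq> {y. u i \<bullet> y \<le> 1}" if "i \<in> I" for i
    using uv that by (intro hull_minimal) (auto simp: convex_halfspace_le)
  then have "y \<bullet> u i \<le> 1" if "i \<in> I" "y \<in> convex hull (v ` I)" for i y
    using that by (auto simp: inner_commute)
  then have "convex hull (u ` I) \<subseteq> {x. y \<bullet> x \<le> 1}" if "y \<in> convex hull (v ` I)" for y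
    using that by (intro hull_minimal) (auto simp: convex_halfspace_le)
  then show "x \<in> {x. \<forall>y \<in> convex hull (v ` I). x \<bullet> y \<le> 1}" if "x \<in> convex hull (u ` I)" for x
    using that by (auto simp: inner_commute)
qed

end

section \<open>Reflexivity and the lattice of the zero-sum hyperplane\<close>

lemma lattice_polytope_hull:
  assumes "finite A" "A \<subseteq> integer_lattice"
  shows "lattice_polytope (convex hull A)"
  using assms extreme_point_of_convex_hull by (auto simp: lattice_polytope_def polytope_def)

text \<open>Affine independence makes each \<open>u i\<close> an extreme point of the dual, so the
  lattice condition misses none of them.\<close>

lemma lattice_polytope_dual_iff:
  fixes v u :: "'i \<Rightarrow> real ^ 'd::finite"
  assumes "simplex_with_dual I v u c"
  shows "lattice_polytope (dual_polytope (convex hull (v ` I))) \<longleftrightarrow> u ` I \<subseteq> integer_lattice"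
proof -
  interpret simplex_with_dual I v u c by fact
  have "dual_polytope (convex hull (v ` I)) = convex hull (u ` I)"
    unfolding dual_polytope_def by (rule polar_eq)
  then show ?thesis
    using u_indep fin lattice_polytope_hull[of "u ` I"]
    by (auto simp: lattice_polytope_def extreme_point_of_convex_hull_affine_independent)
qed

text \<open>A nonzero lattice vector would pair to an integer below 1, hence to a nonpositive number,
  with every vertex of the dual, and so with every point of the dual.\<close>

lemma origin_reflexive_interior_lattice_point:
  fixes Q :: "(real ^ 'd::finite) set"
  assumes Q: "origin_reflexive Q" and x: "x \<in> interior Q" "x \<in> integer_lattice"
  shows "x = 0"
proof (rule ccontr)
  assume x0: "x \<noteq> 0"
  let ?D = "dual_polytope Q"
  have D: "polytope ?D" "\<And>u. u extreme_point_of ?D \<Longrightarrow> u \<in> integer_lattice" and "polytope Q"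
    using Q by (auto simp: origin_reflexive_def lattice_polytope_def)
  obtain e where e: "e > 0" "cball x e \<subseteq> Q" using x(1) mem_interior_cball by blast
  \<comment> \<open>Since \<open>x\<close> is interior, it can be pushed a little in direction
    \<open>u\<close> without leaving \<open>Q\<close>, which makes the inequality strict.\<close>
  have lt: "u \<bullet> x < 1" if u: "u \<in> ?D" for u
  proof (cases "u = 0")
    case False
    have "x + (e / norm u) *\<^sub>R u \<in> Q" using e False by (intro subsetD[OF e(2)]) (simp add: dist_norm)
    then have "u \<bullet> (x + (e / norm u) *\<^sub>R u) \<le> 1" using u by (auto simp: dual_polytope_def)
    moreover have "0 < (e / norm u) * (u \<bullet> u)" using e False by simp
    ultimately show ?thesis by (simp add: inner_add_right)
  qed simp
  have "u \<bullet> x \<le> 0" if u: "u extreme_point_of ?D" for u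
  proof -
    have "u \<bullet> x \<in> \<int>"
      using D(2)[OF u] x(2) by (auto simp: inner_vec_def integer_lattice_def)
    moreover have "u \<bullet> x < 1" using lt u by (auto simp: extreme_point_of_def)
    ultimately show ?thesis by (auto elim!: Ints_cases)
  qed
  then have "{u. u extreme_point_of ?D} \<subseteq> {u. x \<bullet> u \<le> 0}" by (auto simp: inner_commute)
  then have "convex hull {u. u extreme_point_of ?D} \<subseteq> {u. x \<bullet> u \<le> 0}"
    by (intro hull_minimal) (auto simp: convex_halfspace_le)
  then have le: "?D \<subseteq> {u. x \<bullet> u \<le> 0}"
    using Krein_Milman_Minkowski[OF polytope_imp_compact[OF D(1)] polytope_imp_convex[OF D(1)]] by simp
  obtain B where B: "B > 0" "\<And>y. y \<in> Q \<Longrightarrow> norm y \<le> B"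
    using polytope_imp_bounded[OF \<open>polytope Q\<close>] by (auto simp: bounded_pos)
  \<comment> \<open>Boundedness of \<open>Q\<close> puts a small positive multiple of
    \<open>x\<close> into the dual, where the pairing with \<open>x\<close> is positive.\<close>
  have "(1 / (norm x * B)) *\<^sub>R x \<in> ?D" unfolding dual_polytope_def
  proof (intro CollectI ballI)
    fix y assume "y \<in> Q"
    then have "x \<bullet> y \<le> norm x * B"
      using norm_cauchy_schwarz[of x y] B mult_left_mono[of "norm y" B "norm x"] by fastforce
    then show "(1 / (norm x * B)) *\<^sub>R x \<bullet> y \<le> 1" using x0 B(1) by (simp add: divide_le_eq)
  qed
  then have "x \<bullet> ((1 / (norm x * B)) *\<^sub>R x) \<le> 0" using le by blast
  moreover have "0 < x \<bullet> ((1 / (norm x * B)) *\<^sub>R x)" using x0 B(1) by simp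
  ultimately show False by linarith
qed

text \<open>Self-duality of the integer lattice: it turns integrality of coordinates into
  integrality of pairings, which survives a change of coordinates.\<close>

lemma integer_lattice_iff_inner:
  "u \<in> integer_lattice \<longleftrightarrow> (\<forall>y \<in> integer_lattice. u \<bullet> y \<in> \<int>)"
proof
  assume "\<forall>y \<in> integer_lattice. u \<bullet> y \<in> \<int>"
  moreover have "axis k 1 \<in> integer_lattice" for k by (simp add: integer_lattice_def axis_def)
  ultimately have "u \<bullet> axis k 1 \<in> \<int>" for k by blast
  then show "u \<in> integer_lattice" by (simp add: integer_lattice_def inner_axis)
qed (auto simp: inner_vec_def integer_lattice_def)

lemma subspace_zero_sum_hyperplane: "subspace zero_sum_hyperplane"
  by (auto simp: subspace_def zero_sum_hyperplane_def sum.distrib simp flip: sum_distrib_left)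

text \<open>Deleting one coordinate is inverted by filling it in with minus the sum of the others,
  and both maps preserve integrality.\<close>

lemma exists_unimodular_projection:
  assumes "CARD('n::finite) = CARD('d::finite) + 1"
  obtains h :: "real ^ 'n \<Rightarrow> real ^ 'd" where "linear h" "bij_betw h zero_sum_hyperplane UNIV"
    "h ` (zero_sum_hyperplane \<inter> integer_lattice) = integer_lattice"
proof -
  obtain a :: 'n where True by auto
  have "card (UNIV :: 'd set) = card (UNIV - {a})" using assms by simp
  then obtain f :: "'d \<Rightarrow> 'n" where f: "bij_betw f UNIV (UNIV - {a})"
    using finite_same_card_bij[of "UNIV :: 'd set" "UNIV - {a}"] by auto
  define h :: "real ^ 'n \<Rightarrow> real ^ 'd" where "h x = (\<chi> k. x $ f k)" for x
  define g :: "real ^ 'd \<Rightarrow> real ^ 'n" where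
    "g y = (\<chi> j. if j = a then - (\<Sum>k\<in>UNIV. y $ k) else y $ inv_into UNIV f j)" for y
  have f_inv: "inv_into UNIV f (f k) = k" "f k \<noteq> a" for k
    using f by (auto simp: bij_betw_def)
  have f_surj: "f (inv_into UNIV f j) = j" if "j \<noteq> a" for j
    using f that by (intro f_inv_into_f) (auto simp: bij_betw_def)
  have split: "(\<Sum>j\<in>UNIV. x $ j) = x $ a + (\<Sum>k\<in>UNIV. x $ f k)" for x :: "real ^ 'n"
    using sum.reindex_bij_betw[OF f, of "\<lambda>j. x $ j"] by (simp add: sum.remove[of UNIV a])
  have hg: "h (g y) = y" for y by (simp add: h_def g_def f_inv vec_eq_iff)
  have gH: "g y \<in> zero_sum_hyperplane" for y
    unfolding zero_sum_hyperplane_def mem_Collect_eq split by (simp add: g_def f_inv)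
  have gh: "g (h x) = x" if "x \<in> zero_sum_hyperplane" for x
    using that by (auto simp: zero_sum_hyperplane_def split h_def g_def vec_eq_iff f_surj)
  have gL: "g y \<in> integer_lattice" if "y \<in> integer_lattice" for y
    using that by (auto simp: integer_lattice_def g_def)
  have hL: "h x \<in> integer_lattice" if "x \<in> integer_lattice" for x
    using that by (auto simp: integer_lattice_def h_def)
  show ?thesis
  proof (rule that)
    show "linear h" by (rule linearI) (simp_all add: h_def vec_eq_iff)
    show "bij_betw h zero_sum_hyperplane UNIV"
      by (rule bij_betw_byWitness[of _ g]) (auto simp: hg gh gH)
    show "h ` (zero_sum_hyperplane \<inter> integer_lattice) = integer_lattice"
      using hL gL gH hg by (auto intro!: image_eqI[of _ h "g _"])
  qed
qed

text \<open>Here \<open>u i\<close> is defined on all of \<open>\<real>\<^sup>n\<close>; only its restriction to the hyperplane matters.\<close>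

locale hyperplane_simplex =
  fixes I :: "'i set" and v u :: "'i \<Rightarrow> real ^ 'n::finite" and c :: "'i \<Rightarrow> real"
  assumes card_I: "card I = CARD('n)"
    and c_pos: "\<And>i. i \<in> I \<Longrightarrow> 0 < c i"
    and barycenter: "(\<Sum>i\<in>I. c i *\<^sub>R v i) = 0"
    and dual: "\<And>i j. i \<in> I \<Longrightarrow> j \<in> I \<Longrightarrow> u i \<bullet> v j = 1 - (if i = j then sum c I / c i else 0)"
    and v_lattice: "\<And>i. i \<in> I \<Longrightarrow> v i \<in> zero_sum_hyperplane \<inter> integer_lattice"
begin

lemma fin_I: "finite I"
  using card_I by (intro card_ge_0_finite) simp

text \<open>Vertices move along \<open>h\<close>; functionals move by the adjoint of a left inverse
  of \<open>h\<close> on the hyperplane, so that all pairings are preserved.\<close>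

lemma transport:
  fixes h :: "real ^ 'n \<Rightarrow> real ^ 'd::finite"
  assumes dim: "CARD('n) = CARD('d) + 1"
    and h: "linear h" "bij_betw h zero_sum_hyperplane UNIV"
  obtains u' where "simplex_with_dual I (\<lambda>i. h (v i)) u' c"
    and "\<And>i x. i \<in> I \<Longrightarrow> x \<in> zero_sum_hyperplane \<Longrightarrow> u' i \<bullet> h x = u i \<bullet> x"
proof -
  obtain g where g: "linear g" "\<forall>x\<in>zero_sum_hyperplane. g (h x) = x"
    using linear_exists_left_inverse_on[OF h(1) subspace_zero_sum_hyperplane] h(2)
    by (auto simp: bij_betw_def)
  define u' where "u' i = adjoint g (u i)" for i
  have u': "u' i \<bullet> h x = u i \<bullet> x" if "x \<in> zero_sum_hyperplane" for i x
    using adjoint_works[OF g(1)] g(2) that by (simp add: u'_def inner_commute)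
  have "(\<Sum>i\<in>I. c i *\<^sub>R h (v i)) = h (\<Sum>i\<in>I. c i *\<^sub>R v i)"
    using h(1) by (simp add: linear_sum linear_cmul)
  then have "(\<Sum>i\<in>I. c i *\<^sub>R h (v i)) = 0"
    using barycenter linear_0[OF h(1)] by simp
  then have "simplex_with_dual I (\<lambda>i. h (v i)) u' c"
    using card_I dim fin_I c_pos dual v_lattice by unfold_locales (auto simp: u')
  with u' show ?thesis using that by blast
qed

lemma image_hull: "linear h \<Longrightarrow> h ` (convex hull (v ` I)) = convex hull ((\<lambda>i. h (v i)) ` I)"
  by (simp add: convex_hull_linear_image image_image)

lemma origin_reflexive_image_iff:
  fixes h :: "real ^ 'n \<Rightarrow> real ^ 'd::finite"
  assumes dim: "CARD('n) = CARD('d) + 1"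
    and h: "linear h" "bij_betw h zero_sum_hyperplane UNIV"
    and hL: "h ` (zero_sum_hyperplane \<inter> integer_lattice) = integer_lattice"
  shows "origin_reflexive (h ` (convex hull (v ` I))) \<longleftrightarrow>
    (\<forall>i\<in>I. \<forall>x\<in>zero_sum_hyperplane \<inter> integer_lattice. u i \<bullet> x \<in> \<int>)"
proof -
  obtain u' where s: "simplex_with_dual I (\<lambda>i. h (v i)) u' c"
    and u': "\<And>i x. i \<in> I \<Longrightarrow> x \<in> zero_sum_hyperplane \<Longrightarrow> u' i \<bullet> h x = u i \<bullet> x"
    using transport[OF dim h] by blast
  have "lattice_polytope (convex hull ((\<lambda>i. h (v i)) ` I))"
    using v_lattice hL fin_I by (intro lattice_polytope_hull) auto
  then have "origin_reflexive (h ` (convex hull (v ` I))) \<longleftrightarrow> u' ` I \<subseteq> integer_lattice"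
    using simplex_with_dual.zero_in_interior[OF s] lattice_polytope_dual_iff[OF s]
    by (simp add: origin_reflexive_def image_hull[OF h(1)])
  also have "\<dots> \<longleftrightarrow> (\<forall>i\<in>I. \<forall>y\<in>h ` (zero_sum_hyperplane \<inter> integer_lattice). u' i \<bullet> y \<in> \<int>)"
    unfolding hL by (auto simp: integer_lattice_iff_inner[of "u' _"])
  finally show ?thesis by (simp add: u')
qed

text \<open>An equivalence may a priori include a translation by some \<open>a\<close>. The origin
  is then mapped to \<open>a\<close>, an interior lattice point of a reflexive polytope, which
  forces \<open>a = 0\<close> and leaves the linear case.\<close>

lemma reflexive_iff:
  assumes dim: "CARD('n) = CARD('d::finite) + 1"
  shows "reflexive_in TYPE('d) zero_sum_hyperplane (convex hull (v ` I)) \<longleftrightarrow>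
    (\<forall>i\<in>I. \<forall>x\<in>zero_sum_hyperplane \<inter> integer_lattice. u i \<bullet> x \<in> \<int>)"
proof
  assume "reflexive_in TYPE('d) zero_sum_hyperplane (convex hull (v ` I))"
  then obtain Q :: "(real ^ 'd) set" and h a where Q: "origin_reflexive Q"
    and h: "linear h" "bij_betw (\<lambda>x. h x + a) zero_sum_hyperplane UNIV"
      "(\<lambda>x. h x + a) ` (zero_sum_hyperplane \<inter> integer_lattice) = integer_lattice"
      "(\<lambda>x. h x + a) ` (convex hull (v ` I)) = Q"
    unfolding reflexive_in_def unimodularly_equivalent_def by auto
  have "bij_betw ((\<lambda>y. y - a) \<circ> (\<lambda>x. h x + a)) zero_sum_hyperplane UNIV"
    using h(2) by (rule bij_betw_trans) (auto intro!: bij_betw_byWitness[of _ "\<lambda>y. y + a"])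
  then have bij: "bij_betw h zero_sum_hyperplane UNIV" by (simp add: o_def)
  obtain u' where "simplex_with_dual I (\<lambda>i. h (v i)) u' c"
    using transport[OF dim h(1) bij] by blast
  then have "0 \<in> interior (h ` (convex hull (v ` I)))"
    using simplex_with_dual.zero_in_interior image_hull[OF h(1)] by metis
  moreover have "Q = (+) a ` h ` (convex hull (v ` I))"
    using h(4) by (auto simp: image_image add.commute)
  ultimately have "a \<in> interior Q" by (simp add: interior_translation)
  moreover have "a \<in> integer_lattice"
    unfolding h(3)[symmetric] using linear_0[OF h(1)]
    by (intro image_eqI[of _ _ 0]) (auto simp: zero_sum_hyperplane_def integer_lattice_def)
  ultimately have "a = 0" using origin_reflexive_interior_lattice_point[OF Q] by blast
  then show "\<forall>i\<in>I. \<forall>x\<in>zero_sum_hyperplane \<inter> integer_lattice. u i \<bullet> x \<in> \<int>"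
    using origin_reflexive_image_iff[OF dim h(1) bij] h(3,4) Q by simp
next
  assume u: "\<forall>i\<in>I. \<forall>x\<in>zero_sum_hyperplane \<inter> integer_lattice. u i \<bullet> x \<in> \<int>"
  obtain h :: "real ^ 'n \<Rightarrow> real ^ 'd" where h: "linear h" "bij_betw h zero_sum_hyperplane UNIV"
    "h ` (zero_sum_hyperplane \<inter> integer_lattice) = integer_lattice"
    using exists_unimodular_projection[OF dim] by blast
  then have "origin_reflexive (h ` (convex hull (v ` I)))"
    using origin_reflexive_image_iff[OF dim] u by blast
  moreover have "unimodularly_equivalent zero_sum_hyperplane (convex hull (v ` I)) UNIV
      (h ` (convex hull (v ` I)))"
    unfolding unimodularly_equivalent_def using h by (intro exI[of _ h] exI[of _ 0]) simp
  ultimately show "reflexive_in TYPE('d) zero_sum_hyperplane (convex hull (v ` I))"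
    unfolding reflexive_in_def by blast
qed

end

text \<open>The lattice of the hyperplane is generated by the differences of unit vectors.\<close>

lemma inner_hyperplane_lattice_iff:
  fixes u :: "real ^ 'n::finite"
  shows "(\<forall>x\<in>zero_sum_hyperplane \<inter> integer_lattice. u \<bullet> x \<in> \<int>) \<longleftrightarrow> (\<forall>a b. u $ a - u $ b \<in> \<int>)"
proof (intro iffI ballI allI)
  fix a b :: 'n assume u: "\<forall>x\<in>zero_sum_hyperplane \<inter> integer_lattice. u \<bullet> x \<in> \<int>"
  have "axis a 1 - axis b 1 \<in> zero_sum_hyperplane \<inter> integer_lattice"
    by (auto simp: zero_sum_hyperplane_def integer_lattice_def sum_subtractf axis_def)
  then have "u \<bullet> (axis a 1 - axis b 1) \<in> \<int>" using u by blast
  then show "u $ a - u $ b \<in> \<int>" by (simp add: inner_diff_right inner_axis)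
next
  fix x :: "real ^ 'n" assume u: "\<forall>a b. u $ a - u $ b \<in> \<int>" and x: "x \<in> zero_sum_hyperplane \<inter> integer_lattice"
  obtain b :: 'n where True by auto
  \<comment> \<open>Shifting \<open>u\<close> by the constant \<open>u $ b\<close> changes the
    pairing by a multiple of the coordinate sum of \<open>x\<close>, which is 0.\<close>
  have "u \<bullet> x = (\<Sum>a\<in>UNIV. (u $ a - u $ b) * x $ a) + u $ b * (\<Sum>a\<in>UNIV. x $ a)"
    by (simp add: inner_vec_def left_diff_distrib sum_subtractf sum_distrib_left)
  then have "u \<bullet> x = (\<Sum>a\<in>UNIV. (u $ a - u $ b) * x $ a)"
    using x by (simp add: zero_sum_hyperplane_def)
  moreover have "\<dots> \<in> \<int>" using u x by (intro Ints_sum Ints_mult) (auto simp: integer_lattice_def)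
  ultimately show "u \<bullet> x \<in> \<int>" by simp
qed

section \<open>The cycle and its Laplacian\<close>

definition rot :: "nat \<Rightarrow> nat \<Rightarrow> nat \<Rightarrow> nat" where
  "rot n p i = (i - 1 + p) mod n + 1"

lemma rot_in [simp]: "0 < n \<Longrightarrow> rot n p i \<in> {1..n}"
  by (simp add: rot_def Suc_leI)

lemma rot_0 [simp]: "i \<in> {1..n} \<Longrightarrow> rot n 0 i = i"
  by (auto simp: rot_def)

lemma rot_n [simp]: "i \<in> {1..n} \<Longrightarrow> rot n n i = i"
  using rot_0[of i n] unfolding rot_def by (simp only: mod_add_self2 add_0_right)

lemma rot_rot [simp]: "rot n p (rot n q i) = rot n (q + p) i"
  by (simp add: rot_def mod_simps add.assoc)

lemma rot_eq_iff: "rot n p i = rot n q i \<longleftrightarrow> p mod n = q mod n"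
  by (simp add: rot_def mod_eq_iff_dvd_symdiff_nat)

lemma rot_inj: "p < n \<Longrightarrow> q < n \<Longrightarrow> rot n p i = rot n q i \<longleftrightarrow> p = q"
  by (simp add: rot_eq_iff)

lemma rot_surj:
  assumes "i \<in> {1..n}" "j \<in> {1..n}"
  obtains p where "p < n" "rot n p i = j"
proof
  \<comment> \<open>Modulo \<open>n\<close>, \<open>i - 1\<close> is subtracted by adding
    \<open>n - (i - 1)\<close>, which keeps the natural subtraction exact.\<close>
  have "i - 1 + (n - (i - 1) + (j - 1)) = n + (j - 1)" using assms by auto
  then have "(i - 1 + (n - (i - 1) + (j - 1)) mod n) mod n = (j - 1) mod n"
    by (simp only: mod_add_right_eq mod_add_self1)
  then show "rot n ((n - (i - 1) + (j - 1)) mod n) i = j"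
    using assms by (auto simp: rot_def)
qed (use assms in auto)

lemma cyclic_relabel_eq: "cyclic_relabel n r S = rot n r ` S"
  by (simp add: cyclic_relabel_def rot_def)

locale cycle =
  fixes n :: nat and S :: "nat set"
  assumes n_ge: "3 \<le> n" and S_sub: "S \<subseteq> {1..n}"
begin

definition V :: "nat set" where "V = {1..n}"

lemma finite_V [simp]: "finite V" by (simp add: V_def)

definition nxt :: "nat \<Rightarrow> nat" where "nxt = rot n 1"
text \<open>A backward step is taken as a rotation by \<open>n - 1\<close>, so that all composites
  of steps reduce to congruences of exponents.\<close>

definition prv :: "nat \<Rightarrow> nat" where "prv = rot n (n - 1)"

definition s :: "nat \<Rightarrow> real" where "s i = (if i \<in> S then 1 else 0)"

lemma n_pos: "0 < n" using n_ge by simp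

lemma rot_mem [simp]: "rot n p i \<in> V"
  unfolding V_def using n_pos by (rule rot_in)

lemma rot_0_V [simp]: "i \<in> V \<Longrightarrow> rot n 0 i = i"
  and rot_n_V [simp]: "i \<in> V \<Longrightarrow> rot n n i = i"
  unfolding V_def by (fact rot_0 rot_n)+

lemma nxt_mem [simp]: "nxt i \<in> V" and prv_mem [simp]: "prv i \<in> V"
  unfolding nxt_def prv_def by (rule rot_mem)+

lemma nxt_prv [simp]: "i \<in> V \<Longrightarrow> nxt (prv i) = i"
  and prv_nxt [simp]: "i \<in> V \<Longrightarrow> prv (nxt i) = i"
  using n_pos by (simp_all add: nxt_def prv_def)

lemma nxt_rot: "nxt (rot n p i) = rot n (Suc p) i"
  and rot_nxt: "rot n p (nxt i) = rot n (Suc p) i"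
  by (simp_all add: nxt_def)

lemma prv_rot: "prv (rot n (Suc p) i) = rot n p i"
  using n_pos by (simp add: prv_def rot_eq_iff)

lemma nxt_eq_iff: "i \<in> V \<Longrightarrow> j \<in> V \<Longrightarrow> nxt i = j \<longleftrightarrow> i = prv j"
  and prv_eq_iff: "i \<in> V \<Longrightarrow> j \<in> V \<Longrightarrow> prv i = j \<longleftrightarrow> i = nxt j"
  by (metis nxt_prv prv_nxt)+

text \<open>Here \<open>3 \<le> n\<close> enters: 1 and \<open>n - 1\<close> are not congruent
  modulo \<open>n\<close>. Hence the two possible arcs out of a vertex are different.\<close>

lemma nxt_ne_prv: "nxt i \<noteq> prv i"
  using n_ge by (simp add: rot_eq_iff nxt_def prv_def)

lemma nxt_eq: "i \<in> V \<Longrightarrow> nxt i = (if i = n then 1 else i + 1)"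
  by (auto simp: nxt_def rot_def V_def)

lemma prv_eq: "i \<in> V \<Longrightarrow> prv i = (if i = 1 then n else i - 1)"
proof (cases "i = 1")
  case False
  assume i: "i \<in> V"
  then have "i - 1 + (n - 1) = i - 2 + n" using False by (auto simp: V_def)
  then have "prv i = (i - 2) mod n + 1" by (simp only: prv_def rot_def mod_add_self2)
  then show ?thesis using i False by (auto simp: V_def)
qed (use n_ge in \<open>simp add: prv_def rot_def\<close>)

lemma verts_cycle [simp]: "pverts (cycle_digraph n S) = V"
  by (simp add: cycle_digraph_def V_def)

lemma arcs_cycle_iff:
  "(i, j) \<in> parcs (cycle_digraph n S) \<longleftrightarrow> i \<in> V \<and> (j = nxt i \<or> (i \<in> S \<and> j = prv i))"
proof -
  have "(i, j) \<in> parcs (cycle_digraph n S) \<longleftrightarrow>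
    (1 \<le> i \<and> i < n \<and> j = i + 1) \<or> (i = n \<and> j = 1) \<or>
    (i \<in> S \<and> j = (if i = 1 then n else i - 1))"
    unfolding cycle_digraph_def by simp blast
  moreover have "(1 \<le> i \<and> i < n \<and> j = i + 1) \<or> (i = n \<and> j = 1) \<longleftrightarrow> i \<in> V \<and> j = nxt i"
    using nxt_eq[of i] n_pos by (cases "i = n") (simp_all add: V_def, linarith?)
  moreover have "i \<in> S \<longleftrightarrow> i \<in> V \<and> i \<in> S" using S_sub by (auto simp: V_def)
  ultimately show ?thesis using prv_eq[of i] by metis
qed

lemma laplacian_cycle:
  assumes i: "i \<in> V"
  shows "real_of_int (laplacian (cycle_digraph n S) i x) =
    (if x = i then 1 + s i else 0) - (if x = nxt i then 1 else 0) - (if x = prv i then s i else 0)"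
proof -
  have "out_arcs (cycle_digraph n S) i = insert (i, nxt i) (if i \<in> S then {(i, prv i)} else {})"
    using i by (auto simp: out_arcs_def arcs_cycle_iff)
  then have "real (out_degree (cycle_digraph n S) i) = 1 + s i"
    using nxt_ne_prv by (auto simp: out_degree_def s_def)
  moreover have "{e \<in> parcs (cycle_digraph n S). fst e = i \<and> snd e = x} =
    (if x = nxt i \<or> i \<in> S \<and> x = prv i then {(i, x)} else {})"
    using i by (auto simp: arcs_cycle_iff)
  then have "real (adjacency (cycle_digraph n S) i x) =
      (if x = nxt i then 1 else 0) + (if x = prv i then s i else 0)"
    using nxt_ne_prv by (auto simp: adjacency_def s_def)
  ultimately show ?thesis by (simp add: laplacian_def)
qed

text \<open>With \<open>d j = f j - f (nxt j)\<close> the right-hand side is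
  \<open>d i - s i * d (prv i)\<close>, so a functional meets the vertices of the simplex only
  through its differences along the cycle.\<close>

lemma sum_laplacian_row:
  assumes i: "i \<in> V"
  shows "(\<Sum>x\<in>V. f x * real_of_int (laplacian (cycle_digraph n S) i x)) =
    (f i - f (nxt i)) - s i * (f (prv i) - f i)"
proof -
  have "(\<Sum>x\<in>V. f x * real_of_int (laplacian (cycle_digraph n S) i x)) =
    (\<Sum>x\<in>V. (if x = i then f x * (1 + s i) else 0) - (if x = nxt i then f x else 0)
      - (if x = prv i then f x * s i else 0))"
    unfolding laplacian_cycle[OF i] right_diff_distrib by (intro sum.cong refl) simp
  also have "\<dots> = f i * (1 + s i) - f (nxt i) - f (prv i) * s i"
    using i by (simp add: sum_subtractf)
  finally show ?thesis by (simp add: algebra_simps)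
qed

text \<open>If the right-hand side vanishes at every \<open>x\<close>, then \<open>f\<close> gives a
  linear relation among the rows; this is the balance condition on barycentric weights.\<close>

lemma sum_laplacian_col:
  assumes x: "x \<in> V"
  shows "(\<Sum>i\<in>V. f i * real_of_int (laplacian (cycle_digraph n S) i x)) =
    f x * (1 + s x) - f (prv x) - f (nxt x) * s (nxt x)"
proof -
  have "(\<Sum>i\<in>V. f i * real_of_int (laplacian (cycle_digraph n S) i x)) =
    (\<Sum>i\<in>V. (if i = x then f i * (1 + s i) else 0) - (if i = prv x then f i else 0)
      - (if i = nxt x then f i * s i else 0))"
  proof (intro sum.cong refl)
    fix i assume i: "i \<in> V"
    \<comment> \<open>The conditions are solved for the summation index \<open>i\<close>, so that
      each indicator selects one summand.\<close>
    have e: "x = nxt i \<longleftrightarrow> i = prv x" "x = prv i \<longleftrightarrow> i = nxt x"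
      using nxt_eq_iff[OF i x] prv_eq_iff[OF i x] by auto
    show "f i * real_of_int (laplacian (cycle_digraph n S) i x) =
      (if i = x then f i * (1 + s i) else 0) - (if i = prv x then f i else 0)
      - (if i = nxt x then f i * s i else 0)"
      unfolding laplacian_cycle[OF i] e eq_commute[of x i] right_diff_distrib
        if_distrib[of "(*) (f i)"] by simp
  qed
  also have "\<dots> = f x * (1 + s x) - f (prv x) - f (nxt x) * s (nxt x)"
    using x by (simp add: sum_subtractf)
  finally show ?thesis .
qed

text \<open>Minus the partial sums of \<open>d\<close> from vertex 1 work along the path to
  \<open>n\<close>, and the vanishing total closes the cycle. Since they start at 0, integral
  \<open>d\<close> gives integral values.\<close>

lemma potential_exists:
  assumes "(\<Sum>j\<in>V. d j) = (0::real)"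
  obtains f where "\<And>j. j \<in> V \<Longrightarrow> f j - f (nxt j) = d j"
    and "(\<forall>x\<in>V. \<forall>y\<in>V. f x - f y \<in> \<int>) \<longleftrightarrow> (\<forall>j\<in>V. d j \<in> \<int>)"
proof
  define f where "f j = - (\<Sum>q\<in>{1..<j}. d q)" for j
  have d: "f j - f (nxt j) = d j" if j: "j \<in> V" for j
  proof (cases "j = n")
    case True
    have "V = insert n {1..<n}" using n_pos by (auto simp: V_def)
    then show ?thesis using assms True j by (simp add: f_def nxt_eq)
  next
    case False
    then show ?thesis using j by (auto simp: f_def nxt_eq V_def)
  qed
  show "f j - f (nxt j) = d j" if "j \<in> V" for j using that by (rule d)
  show "(\<forall>x\<in>V. \<forall>y\<in>V. f x - f y \<in> \<int>) \<longleftrightarrow> (\<forall>j\<in>V. d j \<in> \<int>)"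
  proof (intro iffI ballI)
    fix j assume "\<forall>x\<in>V. \<forall>y\<in>V. f x - f y \<in> \<int>" "j \<in> V"
    then show "d j \<in> \<int>" using d[of j] nxt_mem[of j] by metis
  next
    fix x y assume dZ: "\<forall>j\<in>V. d j \<in> \<int>" and "x \<in> V" "y \<in> V"
    then have "f x \<in> \<int>" "f y \<in> \<int>" by (auto simp: f_def V_def intro!: Ints_minus Ints_sum)
    then show "f x - f y \<in> \<int>" by simp
  qed
qed

section \<open>Runs of \<open>S\<close>, their lengths, and the recurrence they solve\<close>

definition runs :: "nat \<Rightarrow> nat set" where
  "runs i = {k. \<forall>p<k. rot n (Suc p) i \<in> S}"

text \<open>As 0 always belongs to \<open>runs i\<close>, this is one more than the length of the
  run after \<open>i\<close> when \<open>S\<close> is proper; for \<open>S = V\<close> the set is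
  infinite and the value is 0.\<close>

definition weight :: "nat \<Rightarrow> nat" where
  "weight i = card (runs i)"

text \<open>It marks \<open>i\<close> and the run following it. For proper \<open>S\<close> this is,
  as a function of \<open>j\<close>, the 0/1 solution of the recurrence with a unit source at
  \<open>i\<close>.\<close>

definition reach :: "nat \<Rightarrow> nat \<Rightarrow> bool" where
  "reach i j \<longleftrightarrow> (\<exists>k\<in>runs i. rot n k i = j)"

text \<open>Runs are peeled from the front here, for the recursion of \<open>weight\<close>, and
  from the end in \<open>Suc_runs_iff'\<close>, for \<open>reach\<close> and for chains.\<close>

lemma Suc_runs_iff: "Suc k \<in> runs i \<longleftrightarrow> nxt i \<in> S \<and> k \<in> runs (nxt i)"
  by (simp add: runs_def rot_nxt All_less_Suc2) (simp add: nxt_def)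

lemma Suc_runs_iff': "Suc k \<in> runs i \<longleftrightarrow> rot n (Suc k) i \<in> S \<and> k \<in> runs i"
  by (auto simp: runs_def less_Suc_eq)

lemma zero_runs [simp]: "0 \<in> runs i" by (simp add: runs_def)

lemma runs_mono: "k \<in> runs i \<Longrightarrow> j \<le> k \<Longrightarrow> j \<in> runs i"
  by (auto simp: runs_def)

end

locale proper_cycle = cycle +
  assumes S_ne: "S \<noteq> V"
begin

text \<open>A run of length \<open>n\<close> passes through every vertex, which would make
  \<open>S\<close> all of \<open>V\<close>.\<close>

lemma runs_lt:
  assumes "i \<in> V" "k \<in> runs i"
  shows "k < n"
proof (rule ccontr)
  assume "\<not> k < n"
  then have k: "rot n p i \<in> S" if "0 < p" "p \<le> n" for p
    using assms(2) that by (cases p) (auto simp: runs_def)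
  have "j \<in> S" if j: "j \<in> V" for j
  proof -
    obtain p where p: "p < n" "rot n p i = j" using assms(1) j unfolding V_def by (rule rot_surj)
    show ?thesis
    \<comment> \<open>The start \<open>i\<close> is not tested at position 0; it comes back as
      position \<open>n\<close>.\<close>
    proof (cases "p = 0")
      case True
      then have "rot n n i = j" using p assms(1) by simp
      then show ?thesis using k[of n] n_pos by auto
    qed (use p k[of p] in auto)
  qed
  then show False using S_sub S_ne V_def by blast
qed

lemma finite_runs: "i \<in> V \<Longrightarrow> finite (runs i)"
  using runs_lt by (meson bounded_nat_set_is_finite)

lemma runs_eq:
  assumes i: "i \<in> V"
  shows "runs i = {..<weight i}"
proof -
  define m where "m = Max (runs i)"
  have "m \<in> runs i" unfolding m_def using finite_runs[OF i] zero_runs by (intro Max_in) blast+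
  then have "{..m} \<subseteq> runs i" using runs_mono by blast
  moreover have "runs i \<subseteq> {..m}" using Max_ge[OF finite_runs[OF i]] by (auto simp: m_def)
  ultimately have "runs i = {..m}" by blast
  then show ?thesis by (simp add: weight_def lessThan_Suc_atMost)
qed

lemma weight_pos: "i \<in> V \<Longrightarrow> 0 < weight i"
  using runs_eq[of i] zero_runs[of i] by auto

lemma weight_step:
  assumes i: "i \<in> V"
  shows "weight i = (if nxt i \<in> S then weight (nxt i) + 1 else 1)"
proof -
  have "runs i = insert 0 (Suc ` (if nxt i \<in> S then runs (nxt i) else {}))"
  proof (intro set_eqI)
    fix k show "k \<in> runs i \<longleftrightarrow> k \<in> insert 0 (Suc ` (if nxt i \<in> S then runs (nxt i) else {}))"
      by (cases k) (auto simp: Suc_runs_iff)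
  qed
  then show ?thesis using finite_runs[of "nxt i"] by (auto simp: weight_def card_image)
qed

lemma reach_refl: "i \<in> V \<Longrightarrow> reach i i"
  using zero_runs rot_0_V unfolding reach_def by blast

text \<open>Away from \<open>i\<close>, a vertex is reached iff it lies in \<open>S\<close> and its
  predecessor is reached. If \<open>i\<close> lies in \<open>S\<close>, reaching
  \<open>prv i\<close> would extend to a run of length \<open>n\<close>, which a proper
  \<open>S\<close> excludes.\<close>

lemma reach_step:
  assumes i: "i \<in> V" and j: "j \<in> V"
  shows "of_bool (reach i j) - s j * of_bool (reach i (prv j)) = of_bool (i = j)"
proof -
  have 1: "reach i j \<longleftrightarrow> j \<in> S \<and> reach i (prv j)" if ne: "i \<noteq> j"
  proof
    assume "reach i j"
    then obtain k where k: "k \<in> runs i" "rot n k i = j" unfolding reach_def by blast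
    then obtain l where l: "k = Suc l" using i ne by (cases k) auto
    then have "prv j = rot n l i" using k(2) prv_rot by metis
    then show "j \<in> S \<and> reach i (prv j)" using k l by (auto simp: reach_def Suc_runs_iff')
  next
    assume jS: "j \<in> S \<and> reach i (prv j)"
    then obtain k where k: "k \<in> runs i" "rot n k i = prv j" unfolding reach_def by blast
    then have "rot n (Suc k) i = nxt (prv j)" by (metis nxt_rot)
    then have "rot n (Suc k) i = j" using j by simp
    then show "reach i j" using k jS unfolding reach_def by (metis Suc_runs_iff')
  qed
  have 2: "\<not> reach i (prv i)" if "i \<in> S"
  proof
    assume "reach i (prv i)"
    then obtain k where k: "k \<in> runs i" "rot n k i = prv i" unfolding reach_def by blast
    then have "rot n (Suc k) i = nxt (prv i)" by (metis nxt_rot)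
    then have ki: "rot n (Suc k) i = i" using i by simp
    then have "Suc k \<in> runs i" using k that by (metis Suc_runs_iff')
    moreover have "k = n - 1" using k runs_lt[OF i k(1)] n_pos by (simp add: prv_def rot_eq_iff)
    ultimately show False using runs_lt[OF i, of "Suc k"] n_pos by auto
  qed
  show ?thesis
    using 1 2 reach_refl[OF i] by (cases "i = j") (auto simp: s_def)
qed

definition total_weight :: nat where "total_weight = (\<Sum>i\<in>V. weight i)"

text \<open>Superposition of the unit-source solutions over all \<open>i\<close>, so its source is
  the constant 1; counting the pairs in \<open>reach\<close> both ways gives its total.\<close>

definition indeg :: "nat \<Rightarrow> nat" where "indeg j = (\<Sum>i\<in>V. of_bool (reach i j))"

lemma sum_reach:
  assumes i: "i \<in> V"
  shows "(\<Sum>j\<in>V. of_bool (reach i j)) = weight i"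
proof -
  have "bij_betw (\<lambda>k. rot n k i) (runs i) {j\<in>V. reach i j}"
    unfolding bij_betw_def inj_on_def
    using runs_lt[OF i] rot_inj by (auto simp: reach_def)
  then have "card {j\<in>V. reach i j} = weight i" by (simp add: weight_def bij_betw_same_card)
  then show ?thesis by (simp add: of_bool_def sum.If_cases Int_def)
qed

lemma sum_indeg: "(\<Sum>j\<in>V. indeg j) = total_weight"
  unfolding indeg_def total_weight_def using sum_reach by (subst sum.swap) simp

lemma indeg_step:
  assumes j: "j \<in> V"
  shows "real (indeg j) - s j * real (indeg (prv j)) = 1"
proof -
  have "real (indeg j) - s j * real (indeg (prv j)) =
     (\<Sum>i\<in>V. of_bool (reach i j) - s j * of_bool (reach i (prv j)))"
    by (simp add: indeg_def sum_subtractf sum_distrib_left)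
  also have "\<dots> = (\<Sum>i\<in>V. if i = j then 1 else 0)"
    using reach_step j by (intro sum.cong) (simp_all add: of_bool_def)
  finally show ?thesis using j by simp
qed

text \<open>The difference \<open>u j - u (j + 1)\<close> of the \<open>i\<close>-th dual vertex \<open>u\<close>: the weights are the
  barycentric weights of the origin and \<open>indeg\<close> solves the recurrence \<open>d j - s j d (j - 1) = 1\<close>
  everywhere, so it only has to be corrected along the run starting at \<open>i\<close>.\<close>

definition slope :: "nat \<Rightarrow> nat \<Rightarrow> real" where
  "slope i j = indeg j - of_bool (reach i j) * (total_weight / weight i)"

lemma slope_step:
  assumes "i \<in> V" "j \<in> V"
  shows "slope i j - s j * slope i (prv j) = 1 - (if i = j then total_weight / weight i else 0)"
proof -
  have "slope i j - s j * slope i (prv j) = (real (indeg j) - s j * real (indeg (prv j)))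
    - (of_bool (reach i j) - s j * of_bool (reach i (prv j))) * (total_weight / weight i)"
    by (simp add: slope_def algebra_simps)
  then show ?thesis using assms by (simp only: indeg_step reach_step) (simp add: of_bool_def)
qed

text \<open>The correction \<open>total_weight / weight i\<close> occurs at exactly
  \<open>weight i\<close> vertices, so it cancels the total of \<open>indeg\<close>.\<close>

lemma sum_slope: "i \<in> V \<Longrightarrow> (\<Sum>j\<in>V. slope i j) = 0"
proof -
  assume i: "i \<in> V"
  have "(\<Sum>j\<in>V. slope i j) = real (\<Sum>j\<in>V. indeg j)
      - real (\<Sum>j\<in>V. of_bool (reach i j)) * (total_weight / weight i)"
    by (simp only: slope_def sum_subtractf sum_distrib_right of_nat_sum of_nat_of_bool)
  also have "\<dots> = 0" using weight_pos[OF i] by (simp only: sum_indeg sum_reach[OF i]) simp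
  finally show ?thesis .
qed

text \<open>By \<open>weight_step\<close> at \<open>j\<close> and at \<open>prv j\<close>, each
  weight is 1 plus a term from the next vertex; subtracting removes the 1. Thus the weights are the
  coefficients of a linear relation among the rows of the Laplacian.\<close>

lemma weight_balance:
  assumes j: "j \<in> V"
  shows "real (weight j) * (1 + s j) = weight (prv j) + weight (nxt j) * s (nxt j)"
proof -
  have "real (weight j) = 1 + s (nxt j) * weight (nxt j)"
    using weight_step[OF j] by (simp add: s_def)
  moreover have "real (weight (prv j)) = 1 + s j * weight j"
    using weight_step[of "prv j"] j by (simp add: s_def)
  ultimately show ?thesis by (simp add: algebra_simps)
qed

text \<open>Up to integers, \<open>slope i\<close> takes only the values 0 and minus
  \<open>total_weight / weight i\<close>; the latter occurs at \<open>j = i\<close>, so the diagonal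
  decides.\<close>

lemma slope_Ints_iff:
  "(\<forall>i\<in>V. \<forall>j\<in>V. slope i j \<in> \<int>) \<longleftrightarrow> (\<forall>i\<in>V. weight i dvd total_weight)"
proof -
  have dvd: "real total_weight / real (weight i) \<in> \<int> \<longleftrightarrow> weight i dvd total_weight" if "i \<in> V" for i
    using of_int_div_of_int_in_Ints_iff[of "int total_weight" "int (weight i)", where 'a = real] weight_pos[OF that] by simp
  have "real total_weight / real (weight i) = real (indeg i) - slope i i" if "i \<in> V" for i
    using reach_refl[OF that] by (simp add: slope_def)
  then have "weight i dvd total_weight" if "slope i i \<in> \<int>" "i \<in> V" for i
    using that dvd[of i] by (metis Ints_diff Ints_of_nat)
  moreover have "slope i j \<in> \<int>" if "weight i dvd total_weight" "i \<in> V" for i j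
    using that dvd[of i] by (simp add: slope_def)
  ultimately show ?thesis by blast
qed

text \<open>While the weight exceeds 1 the next vertex lies in \<open>S\<close>, and moving there
  lowers the weight by 1.\<close>

lemma weight_downward:
  assumes "a \<in> V" "1 \<le> k" "k \<le> weight a"
  obtains b where "b \<in> V" "weight b = k"
  using assms
proof (induction "weight a - k" arbitrary: a thesis)
  case (Suc m)
  then have w: "weight a = weight (nxt a) + 1"
    using weight_step[of a] by (auto split: if_splits)
  show ?case
  proof (rule Suc.hyps(1))
    show "m = weight (nxt a) - k" "k \<le> weight (nxt a)" using Suc.hyps(2) w by linarith+
  qed (use Suc.prems in auto)
qed auto

text \<open>With 1 outside the relabeled set no run crosses from \<open>n\<close> to 1, so cyclic
  runs become genuine intervals of numbers.\<close>

lemma runs_cyclic_relabel: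
  assumes "1 \<notin> cyclic_relabel n r S" and i: "i \<in> V"
  shows "{rot n r i + 1..rot n r i + k} \<subseteq> cyclic_relabel n r S \<longleftrightarrow> k \<in> runs i"
proof -
  let ?S = "cyclic_relabel n r S"
  have inj: "rot n r x \<in> ?S \<longleftrightarrow> x \<in> S" if "x \<in> V" for x
  proof -
    \<comment> \<open>Rotation by \<open>n - r mod n\<close> undoes rotation by \<open>r\<close>,
      also for \<open>r\<close> beyond \<open>n\<close>; so the relabeling is injective on
      \<open>V\<close>.\<close>
    have "(r + (n - r mod n)) mod n = (r mod n + (n - r mod n)) mod n"
      by (simp only: mod_add_left_eq)
    also have "r mod n + (n - r mod n) = n" using n_pos by (simp add: less_imp_le)
    finally have "(r + (n - r mod n)) mod n = n mod n" .
    then have "rot n (n - r mod n) (rot n r y) = y" if "y \<in> V" for y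
      unfolding rot_rot using that rot_n_V rot_eq_iff by metis
    then have "x = y" if "rot n r x = rot n r y" "y \<in> V" for y
      using that \<open>x \<in> V\<close> by metis
    then show ?thesis using S_sub by (auto simp: cyclic_relabel_eq V_def)
  qed
  let ?a = "rot n r i"
  have sub: "?S \<subseteq> V" using rot_mem by (auto simp: cyclic_relabel_eq)
  have shift: "rot n r (rot n p i) = rot n p ?a" for p by (simp add: add.commute)
  show ?thesis
  proof (induction k)
    case (Suc k)
    have "{?a + 1..?a + Suc k} = insert (?a + Suc k) {?a + 1..?a + k}" by auto
    then have "{?a + 1..?a + Suc k} \<subseteq> ?S \<longleftrightarrow> ?a + Suc k \<in> ?S \<and> k \<in> runs i"
      using Suc.IH by auto
    moreover have "?a + Suc k \<in> ?S \<longleftrightarrow> rot n (Suc k) ?a \<in> ?S" if "k \<in> runs i"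
    proof -
      have le: "?a + k \<le> n"
      proof (cases k)
        case 0 then show ?thesis using rot_mem[of r i] by (simp add: V_def)
      next
        case (Suc l)
        then have "?a + k \<in> {?a + 1..?a + k}" by simp
        then have "?a + k \<in> ?S" using Suc.IH that by blast
        then show ?thesis using sub by (auto simp: V_def)
      qed
      have a: "1 \<le> ?a" by (simp add: rot_def)
      show ?thesis
      proof (cases "?a + k = n")
        \<comment> \<open>At the seam both sides fail: the rotation lands on the excluded vertex 1,
          the interval on \<open>n + 1\<close>.\<close>
        case True
        then have "?a - 1 + Suc k = n" using a by simp
        then have "rot n (Suc k) ?a = 1" by (simp only: rot_def[of n "Suc k"] mod_self)
        moreover have "?a + Suc k \<notin> ?S" using sub True by (auto simp: V_def)
        ultimately show ?thesis using assms(1) by simp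
      next
        case False
        then have "?a - 1 + Suc k < n" "?a - 1 + Suc k + 1 = ?a + Suc k" using le a by linarith+
        then have "rot n (Suc k) ?a = ?a + Suc k" by (simp only: rot_def[of n "Suc k"] mod_less)
        then show ?thesis by simp
      qed
    qed
    moreover have "rot n (Suc k) ?a \<in> ?S \<longleftrightarrow> rot n (Suc k) i \<in> S"
      using inj[OF rot_mem[of "Suc k" i]] unfolding shift .
    ultimately show ?case by (auto simp: Suc_runs_iff')
  qed simp
qed

text \<open>The chain lengths available from \<open>i\<close> are
  \<open>0, ..., weight i - 1\<close>, so the maximal weight is the longest chain plus 1;
  \<open>weight_downward\<close> supplies all smaller values.\<close>

lemma weights_eq:
  assumes "1 \<notin> cyclic_relabel n r S"
  shows "weight ` V = {1..longest_ccw_chain n (cyclic_relabel n r S) + 1}"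
proof -
  let ?J = "{j. \<exists>a\<in>{1..n}. {a + 1..a + j} \<subseteq> cyclic_relabel n r S}"
  have rot_V: "rot n r ` V = V"
  proof -
    have "\<exists>i\<in>V. a = rot n r i" if a: "a \<in> V" for a
    proof -
      obtain p where p: "p < n" "rot n p (rot n r a) = a"
        using rot_surj[OF rot_mem[of r a, unfolded V_def]] a unfolding V_def by blast
      then have "a = rot n r (rot n p a)" by (simp add: add.commute)
      then show ?thesis using rot_mem by blast
    qed
    then show ?thesis using rot_mem by blast
  qed
  have "?J = {j. \<exists>i\<in>V. {rot n r i + 1..rot n r i + j} \<subseteq> cyclic_relabel n r S}"
    unfolding V_def[symmetric] by (subst rot_V[symmetric]) simp
  also have "\<dots> = (\<Union>i\<in>V. runs i)"
    using runs_cyclic_relabel[OF assms] by blast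
  finally have J: "?J = (\<Union>i\<in>V. {..<weight i})" using runs_eq by simp
  let ?K = "longest_ccw_chain n (cyclic_relabel n r S)"
  have K: "?K = Max (\<Union>i\<in>V. {..<weight i})"
    unfolding longest_ccw_chain_def J ..
  have V1: "1 \<in> V" using n_pos by (simp add: V_def)
  have fin: "finite (\<Union>i\<in>V. {..<weight i})" by simp
  have "?K \<in> (\<Union>i\<in>V. {..<weight i})"
    unfolding K using V1 weight_pos[OF V1] by (intro Max_in fin) blast
  then obtain a where a: "a \<in> V" "?K + 1 \<le> weight a" by auto
  show ?thesis
  proof (intro equalityI subsetI)
    fix k assume "k \<in> weight ` V"
    then obtain i where i: "i \<in> V" "k = weight i" by blast
    then have "weight i - 1 \<in> (\<Union>i\<in>V. {..<weight i})" using weight_pos[OF i(1)] by force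
    then have "weight i - 1 \<le> ?K" unfolding K by (intro Max_ge fin)
    then show "k \<in> {1..?K + 1}" using weight_pos[OF i(1)] i by simp
  next
    fix k assume "k \<in> {1..?K + 1}"
    then show "k \<in> weight ` V"
      using weight_downward[OF a(1), of k] a(2) by (metis atLeastAtMost_iff image_eqI le_trans)
  qed
qed

end

section \<open>Spanning converging trees\<close>

text \<open>Induction along an undirected walk from \<open>r\<close>. An arc pointing to the
  previous vertex of the walk extends its path to \<open>r\<close>. An arc leaving that vertex is
  its only one, hence the first arc of its path to \<open>r\<close>.\<close>

lemma converging_tree_reach_root:
  assumes wf: "wf_digraph T" and fin: "finite (arcs T)" and con: "Digraph_Component.connected T"
    and r: "r \<in> verts T" "out_degree T r = 0"
    and out: "\<And>v. v \<in> verts T - {r} \<Longrightarrow> out_degree T v = 1"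
    and v: "v \<in> verts T"
  shows "(v, r) \<in> (arcs_ends T)\<^sup>*"
proof -
  interpret wf_digraph T by (rule wf)
  have "r \<rightarrow>\<^sup>*\<^bsub>mk_symmetric T\<^esub> v"
    using con r v by (auto simp: Digraph_Component.connected_def strongly_connected_def)
  then have "(r, v) \<in> (parcs (mk_symmetric T))\<^sup>*"
    using reachable_rtranclI[of "with_proj (mk_symmetric T)"] by simp
  then show ?thesis
  proof (induction rule: rtrancl_induct)
    case (step y z)
    from step(2) obtain e where e: "e \<in> arcs T"
      and yz: "tail T e = y \<and> head T e = z \<or> tail T e = z \<and> head T e = y"
      by (auto simp: parcs_mk_symmetric)
    show ?case
    proof (cases "tail T e = z \<and> head T e = y")
      case True
      then have "(z, y) \<in> arcs_ends T" using e by (auto simp: arcs_ends_def arc_to_ends_def)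
      then show ?thesis using step.IH by (rule converse_rtrancl_into_rtrancl)
    next
      case False
      then have yz: "tail T e = y" "head T e = z" using yz by auto
      show ?thesis
      proof (cases "y = r")
        case True
        then have False using e yz r(2) fin by (auto simp: out_degree_def out_arcs_def)
        then show ?thesis ..
      next
        case False
        then obtain y' where y': "(y, y') \<in> arcs_ends T" "(y', r) \<in> (arcs_ends T)\<^sup>*"
          using step.IH by (meson converse_rtranclE)
        then obtain e' where e': "e' \<in> arcs T" "tail T e' = y" "head T e' = y'"
          by (auto simp: arcs_ends_def arc_to_ends_def)
        have "card (out_arcs T y) = 1"
          using out[of y] False e yz by (auto simp: out_degree_def)
        then obtain x where "out_arcs T y = {x}" by (auto simp: card_1_singleton_iff)
        moreover have "e \<in> out_arcs T y" "e' \<in> out_arcs T y" using e e' yz by (auto simp: out_arcs_def)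
        ultimately have "e = e'" by simp
        then show ?thesis using y' e' yz by simp
      qed
    qed
  qed simp
qed

section \<open>Classification of the spanning converging trees of a cycle digraph\<close>

context cycle
begin

text \<open>Measured clockwise from the root \<open>r\<close>, positions \<open>1, \<dots>, k\<close> point backward and all later ones
  forward.\<close>

definition tree_arcs :: "nat \<Rightarrow> nat \<Rightarrow> (nat \<times> nat) set" where
  "tree_arcs r k = {(rot n p r, rot n (if p \<le> k then p - 1 else p + 1) r) |p. 0 < p \<and> p < n}"

definition tree_digraph :: "nat \<Rightarrow> nat \<Rightarrow> (nat, nat \<times> nat) pre_digraph" where
  "tree_digraph r k = \<lparr>verts = V, arcs = tree_arcs r k, tail = fst, head = snd\<rparr>"

lemma tree_digraph_simps [simp]:
  "verts (tree_digraph r k) = V" "arcs (tree_digraph r k) = tree_arcs r k"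
  "tail (tree_digraph r k) = fst" "head (tree_digraph r k) = snd"
  by (simp_all add: tree_digraph_def)

lemma V_rotE:
  assumes "r \<in> V" "v \<in> V"
  obtains p where "p < n" "v = rot n p r"
  using rot_surj[of r n v] assms unfolding V_def by metis

lemma rot_eq_self_iff: "r \<in> V \<Longrightarrow> p < n \<Longrightarrow> rot n p r = r \<longleftrightarrow> p = 0"
  using rot_inj[of p n 0 r] n_pos by simp

lemma tree_arcs_iff:
  assumes "p < n"
  shows "(rot n p r, y) \<in> tree_arcs r k \<longleftrightarrow> 0 < p \<and> y = rot n (if p \<le> k then p - 1 else p + 1) r"
  using assms rot_inj[of p n _ r] unfolding tree_arcs_def by auto

lemma root_no_tree_arc: "r \<in> V \<Longrightarrow> (r, y) \<notin> tree_arcs r k"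
  using tree_arcs_iff[of 0 r y k] n_pos by simp

lemma wf_tree: "wf_digraph (tree_digraph r k)"
  by unfold_locales (use rot_mem in \<open>auto simp: tree_arcs_def\<close>)

lemma wf_cycle: "wf_digraph (with_proj (cycle_digraph n S))"
  by unfold_locales (auto simp: arcs_cycle_iff)

lemma tree_arcs_subset:
  assumes k: "k \<in> runs r"
  shows "tree_arcs r k \<subseteq> parcs (cycle_digraph n S)"
proof
  fix e assume "e \<in> tree_arcs r k"
  then obtain p where p: "0 < p" "p < n"
    and e: "e = (rot n p r, rot n (if p \<le> k then p - 1 else p + 1) r)"
    by (auto simp: tree_arcs_def)
  obtain q where q: "p = Suc q" using p by (cases p) auto
  show "e \<in> parcs (cycle_digraph n S)"
  proof (cases "p \<le> k")
    case True
    then have "rot n p r \<in> S" using k q by (auto simp: runs_def)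
    then show ?thesis using e True q prv_rot[of q r] by (simp add: arcs_cycle_iff)
  next
    case False
    then show ?thesis using e nxt_rot[of p r] by (simp add: arcs_cycle_iff)
  qed
qed

lemma spanning_tree_digraph:
  "k \<in> runs r \<Longrightarrow> spanning (tree_digraph r k) (with_proj (cycle_digraph n S))"
  using tree_arcs_subset wf_tree wf_cycle
  by (simp add: spanning_def subgraph_def compatible_def)

lemma out_arcs_tree:
  assumes "0 < p" "p < n"
  shows "out_arcs (tree_digraph r k) (rot n p r) =
    {(rot n p r, rot n (if p \<le> k then p - 1 else p + 1) r)}"
proof (rule set_eqI)
  fix e :: "nat \<times> nat"
  obtain a b where "e = (a, b)" by (cases e)
  then show "e \<in> out_arcs (tree_digraph r k) (rot n p r) \<longleftrightarrow>
      e \<in> {(rot n p r, rot n (if p \<le> k then p - 1 else p + 1) r)}"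
    using tree_arcs_iff[OF assms(2), of r b k] assms(1)
    by (cases "a = rot n p r") (simp_all add: out_arcs_def)
qed

lemma tree_reach_root:
  assumes r: "r \<in> V" and v: "v \<in> V"
  shows "v \<rightarrow>\<^sup>*\<^bsub>tree_digraph r k\<^esub> r"
proof -
  interpret wf_digraph "tree_digraph r k" by (rule wf_tree)
  have arc: "rot n p r \<rightarrow>\<^bsub>tree_digraph r k\<^esub> rot n (if p \<le> k then p - 1 else p + 1) r"
    if "0 < p" "p < n" for p
    using tree_arcs_iff[OF that(2), of r _ k] that(1)
    by (intro dominatesI[of "(_, _)"]) (auto simp: arc_to_ends_def)
  \<comment> \<open>Position \<open>n\<close> is the root again; the vertices pointing forward end
    there.\<close>
  have base: "rot n p r \<rightarrow>\<^sup>*\<^bsub>tree_digraph r k\<^esub> r" if "p = 0 \<or> p = n" for p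
    using that r by auto
  have low: "rot n p r \<rightarrow>\<^sup>*\<^bsub>tree_digraph r k\<^esub> r" if "p < n" "p \<le> k" for p
    using that
  proof (induction p)
    case (Suc p)
    then show ?case using arc[of "Suc p"] by (auto intro: adj_reachable_trans)
  qed (use base in simp)
  have high: "rot n p r \<rightarrow>\<^sup>*\<^bsub>tree_digraph r k\<^esub> r" if "p \<le> n" "k < p" for p
    using that
  proof (induction "n - p" arbitrary: p)
    case (Suc m)
    then have "rot n (Suc p) r \<rightarrow>\<^sup>*\<^bsub>tree_digraph r k\<^esub> r" by simp
    moreover have "0 < p" "p < n" "\<not> p \<le> k" using Suc by linarith+
    ultimately show ?case using arc[of p] by (auto intro: adj_reachable_trans)
  qed (use base in simp)
  obtain p where "p < n" "v = rot n p r" using r v by (rule V_rotE)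
  then show ?thesis using low[of p] high[of p] by (cases "p \<le> k") auto
qed

lemma converging_tree_digraph:
  assumes r: "r \<in> V"
  shows "converging_tree (tree_digraph r k)"
proof -
  interpret wf_digraph "tree_digraph r k" by (rule wf_tree)
  interpret sym: wf_digraph "with_proj (mk_symmetric (tree_digraph r k))"
    using wellformed_mk_symmetric by (simp add: wf_digraph_wp_iff)
  have to_r: "v \<rightarrow>\<^sup>*\<^bsub>mk_symmetric (tree_digraph r k)\<^esub> r" if "v \<in> V" for v
    using tree_reach_root[OF r that] by (rule reachable_mk_symmetricI)
  have "u \<rightarrow>\<^sup>*\<^bsub>mk_symmetric (tree_digraph r k)\<^esub> v" if "u \<in> V" "v \<in> V" for u v
    using to_r[OF that(1)] symmetric_reachable[OF symmetric_mk_symmetric to_r[OF that(2)]]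
    by (rule sym.reachable_trans)
  then have "Digraph_Component.connected (tree_digraph r k)"
    using r by (auto simp: Digraph_Component.connected_def strongly_connected_def)
  moreover have "out_degree (tree_digraph r k) r = 0"
    using root_no_tree_arc[OF r] by (auto simp: out_degree_def out_arcs_def card_eq_0_iff)
  moreover have "out_degree (tree_digraph r k) v = 1" if v: "v \<in> V - {r}" for v
  proof -
    obtain p where p: "p < n" "v = rot n p r" using V_rotE[OF r, of v] v by blast
    then have "0 < p" using r v by (cases p) auto
    then show ?thesis using p out_arcs_tree[of p r k] by (simp add: out_degree_def)
  qed
  ultimately show ?thesis using r unfolding converging_tree_def by auto
qed

text \<open>Each vertex other than the root has one arc, forward or backward. Since the root is
  reachable from everywhere, the positions pointing backward form an initial segment, and their arcs
  force them into \<open>S\<close>.\<close>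

lemma converging_tree_eq:
  assumes sp: "spanning T (with_proj (cycle_digraph n S))" and ct: "converging_tree T"
  obtains r k where "r \<in> V" "k \<in> runs r" "T = tree_digraph r k"
proof -
  have T: "verts T = V" "arcs T \<subseteq> parcs (cycle_digraph n S)" "tail T = fst" "head T = snd"
      "wf_digraph T"
    using sp by (auto simp: spanning_def subgraph_def compatible_def)
  interpret wf_digraph T by (rule T)
  have "arcs T \<subseteq> V \<times> V" using T(2) arcs_cycle_iff by fastforce
  then have finT: "finite (arcs T)" by (rule finite_subset) simp
  obtain r where r: "r \<in> V" "out_degree T r = 0"
    and out: "\<And>v. v \<in> V - {r} \<Longrightarrow> out_degree T v = 1"
    and con: "Digraph_Component.connected T"
    using ct T(1) by (auto simp: converging_tree_def)
  have root: "(r, y) \<notin> arcs T" for y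
    using r finT T by (auto simp: out_degree_def out_arcs_def)
  have arcs_ends: "arcs_ends T = arcs T" using T by (simp add: arcs_ends_def arc_to_ends_def)
  have reach: "(v, r) \<in> (arcs T)\<^sup>*" if "v \<in> V" for v
    using converging_tree_reach_root[OF T(5) finT con, of r v] r out that T(1) arcs_ends by auto
  have ex: "\<exists>y. (v, y) \<in> arcs T" and uniq: "(v, y) \<in> arcs T \<Longrightarrow> (v, z) \<in> arcs T \<Longrightarrow> y = z"
    if v: "v \<in> V" "v \<noteq> r" for v y z
  proof -
    obtain e where "out_arcs T v = {e}"
      using out[of v] v by (auto simp: out_degree_def card_1_singleton_iff)
    then have e: "e' \<in> arcs T \<and> fst e' = v \<longleftrightarrow> e' = e" for e'
      using T by (auto simp: out_arcs_def)
    from e[of e] have "(v, snd e) \<in> arcs T" by (cases e) auto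
    then show "\<exists>y. (v, y) \<in> arcs T" ..
    show "y = z" if "(v, y) \<in> arcs T" "(v, z) \<in> arcs T"
      using e[of "(v, y)"] e[of "(v, z)"] that by auto
  qed
  have arc_cases: "y = nxt v \<or> v \<in> S \<and> y = prv v" if "(v, y) \<in> arcs T" for v y
    using T(2) that arcs_cycle_iff by blast
  define B where "B = {p. 0 < p \<and> p < n \<and> (rot n p r, nxt (rot n p r)) \<notin> arcs T}"
  have ne: "rot n p r \<noteq> r" if "0 < p" "p < n" for p using that r rot_eq_self_iff by auto
  have fwd: "(rot n p r, nxt (rot n p r)) \<in> arcs T" if "0 < p" "p < n" "p \<notin> B" for p
    using that by (simp add: B_def)
  have bwd: "(rot n p r, prv (rot n p r)) \<in> arcs T \<and> rot n p r \<in> S" if "p \<in> B" for p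
  proof -
    have p: "0 < p" "p < n" using that by (auto simp: B_def)
    obtain y where "(rot n p r, y) \<in> arcs T" using ex ne[OF p] rot_mem by blast
    then show ?thesis using arc_cases that by (auto simp: B_def)
  qed
  \<comment> \<open>A forward arc followed by a backward one would trap two vertices away from the root.\<close>
  have down: "p \<in> B" if p: "0 < p" "Suc p \<in> B" for p
  proof (rule ccontr)
    assume pB: "p \<notin> B"
    have n: "Suc p < n" using p by (auto simp: B_def)
    let ?W = "{rot n p r, rot n (Suc p) r}"
    have "(rot n p r, rot n (Suc p) r) \<in> arcs T"
      using fwd[of p] p n pB by (simp add: nxt_rot)
    moreover have "(rot n (Suc p) r, rot n p r) \<in> arcs T"
      using bwd[OF p(2)] prv_rot by simp
    ultimately have closed: "y \<in> ?W" if "(v, y) \<in> arcs T" "v \<in> ?W" for v y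
      using that uniq ne[of p] ne[of "Suc p"] p(1) n rot_mem by (metis Suc_lessD insertCI insertE singletonD zero_less_Suc)
    have "y \<in> ?W" if "(rot n p r, y) \<in> (arcs T)\<^sup>*" for y
      using that by (induction rule: rtrancl_induct) (use closed in auto)
    then have "r \<in> ?W" using reach rot_mem by blast
    then show False using ne[of p] ne[of "Suc p"] p(1) n by auto
  qed
  have finB: "finite (insert 0 B)" using finite_subset[of B "{..<n}"] by (auto simp: B_def)
  \<comment> \<open>Inserting 0 covers the tree all of whose arcs point forward.\<close>
  define k where "k = Max (insert 0 B)"
  have kB: "k \<in> insert 0 B" unfolding k_def using finB by (intro Max_in) auto
  have kdown: "q < k \<Longrightarrow> k - q \<in> B" for q
  proof (induction q)
    case (Suc q)
    then have "Suc (k - Suc q) \<in> B" using Suc_diff_Suc[of q k] by simp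
    then show ?case using Suc.prems by (intro down[of "k - Suc q"]) simp_all
  qed (use kB in auto)
  have B: "p \<in> B \<longleftrightarrow> 0 < p \<and> p \<le> k" for p
  proof
    assume "p \<in> B"
    then show "0 < p \<and> p \<le> k" using Max_ge[OF finB, of p] by (auto simp: B_def k_def)
  next
    assume "0 < p \<and> p \<le> k"
    then show "p \<in> B" using kdown[of "k - p"] by simp
  qed
  have runs: "k \<in> runs r" using bwd B by (auto simp: runs_def)
  have in_T: "(rot n p r, rot n (if p \<le> k then p - 1 else p + 1) r) \<in> arcs T"
    if p: "0 < p" "p < n" for p
  proof -
    obtain q where "p = Suc q" using p by (cases p) auto
    then show ?thesis using fwd[OF p] bwd[of p] p B[of p] by (auto simp: nxt_rot prv_rot)
  qed
  have "arcs T = tree_arcs r k"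
  proof (intro equalityI subrelI)
    fix x y assume "(x, y) \<in> tree_arcs r k"
    then show "(x, y) \<in> arcs T" using in_T by (auto simp: tree_arcs_def)
  next
    fix x y assume xy: "(x, y) \<in> arcs T"
    then have x: "x \<in> V" "x \<noteq> r" using T(2) root arcs_cycle_iff by blast+
    obtain p where p: "p < n" "x = rot n p r" using V_rotE[OF r(1) x(1)] by blast
    then have p0: "0 < p" using r x by (cases p) auto
    have "y = rot n (if p \<le> k then p - 1 else p + 1) r"
      using uniq[OF x xy] in_T[OF p0 p(1)] p(2) by simp
    then show "(x, y) \<in> tree_arcs r k" using p p0 tree_arcs_iff by simp
  qed
  then have "T = tree_digraph r k" using T by (simp add: tree_digraph_def)
  with r runs show ?thesis using that by blast
qed

text \<open>The root is the only vertex of the tree without an outgoing arc.\<close>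

lemma tree_digraph_root_unique:
  assumes "r \<in> V" "r' \<in> V" "tree_arcs r k = tree_arcs r' k'"
  shows "r = r'"
proof (rule ccontr)
  assume "r \<noteq> r'"
  obtain p where p: "p < n" "r = rot n p r'" using V_rotE[OF assms(2,1)] by blast
  then have "0 < p" using assms \<open>r \<noteq> r'\<close> by (cases p) auto
  then have "(r, rot n (if p \<le> k' then p - 1 else p + 1) r') \<in> tree_arcs r' k'"
    using tree_arcs_iff p by simp
  then show False using root_no_tree_arc assms by metis
qed

text \<open>At position \<open>k'\<close> one tree points forward and the other backward, and these
  arcs differ by \<open>nxt_ne_prv\<close>.\<close>

lemma tree_arcs_ne:
  assumes "k < k'" "k' < n"
  shows "tree_arcs r k \<noteq> tree_arcs r k'"
proof
  assume eq: "tree_arcs r k = tree_arcs r k'"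
  obtain q where q: "k' = Suc q" using assms by (cases k') auto
  have "(rot n k' r, rot n q r) \<in> tree_arcs r k" unfolding eq using assms q by (simp add: tree_arcs_iff)
  then have "rot n q r = rot n (Suc k') r" using assms by (simp add: tree_arcs_iff)
  then have "prv (rot n k' r) = nxt (rot n k' r)" by (simp add: q prv_rot nxt_rot)
  then show False using nxt_ne_prv by metis
qed

end

context proper_cycle
begin

theorem complexity_cycle: "complexity (with_proj (cycle_digraph n S)) = total_weight"
proof -
  let ?f = "\<lambda>(r, k). tree_digraph r k"
  have "{T. spanning T (with_proj (cycle_digraph n S)) \<and> converging_tree T} = ?f ` (SIGMA r:V. runs r)"
    using spanning_tree_digraph converging_tree_digraph by (auto elim!: converging_tree_eq)
  moreover have "inj_on ?f (SIGMA r:V. runs r)"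
  proof (rule inj_onI, clarify)
    fix r k r' k' assume A: "r \<in> V" "k \<in> runs r" "r' \<in> V" "k' \<in> runs r'"
      and "tree_digraph r k = tree_digraph r' k'"
    then have eq: "tree_arcs r k = tree_arcs r' k'" by (metis tree_digraph_simps(2))
    then have "r = r'" using tree_digraph_root_unique A by blast
    moreover have "k = k'"
      using tree_arcs_ne[of k k' r] tree_arcs_ne[of k' k r] eq \<open>r = r'\<close> A runs_lt by (metis linorder_neqE_nat)
    ultimately show "r = r' \<and> k = k'" by simp
  qed
  ultimately have "complexity (with_proj (cycle_digraph n S)) = card (SIGMA r:V. runs r)"
    by (simp add: complexity_def card_image)
  also have "\<dots> = total_weight"
    using finite_runs by (simp add: card_SigmaI total_weight_def weight_def)
  finally show ?thesis .
qed

end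

section \<open>Reflexivity of the Laplacian simplex\<close>

context cycle
begin

text \<open>Common reduction of the full and the proper case: it remains to exhibit positive
  coefficients \<open>c\<close> of a relation among the rows and the differences \<open>d i\<close>
  of the dual vertices, which are recovered from \<open>d i\<close> as potentials.\<close>

lemma reflexive_laplacian_iff:
  fixes lab :: "'n::finite \<Rightarrow> nat" and c :: "nat \<Rightarrow> real"
  assumes lab: "bij_betw lab UNIV V" and dim: "CARD('d::finite) + 1 = n"
    and c_pos: "\<And>i. i \<in> V \<Longrightarrow> 0 < c i"
    and balance: "\<And>j. j \<in> V \<Longrightarrow> c j * (1 + s j) = c (prv j) + c (nxt j) * s (nxt j)"
    and step: "\<And>i j. i \<in> V \<Longrightarrow> j \<in> V \<Longrightarrow>
      d i j - s j * d i (prv j) = 1 - (if i = j then sum c V / c i else 0)"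
    and sum_d: "\<And>i. i \<in> V \<Longrightarrow> (\<Sum>j\<in>V. d i j) = 0"
  shows "reflexive_in TYPE('d) zero_sum_hyperplane (laplacian_polytope lab (cycle_digraph n S)) \<longleftrightarrow>
    (\<forall>i\<in>V. \<forall>j\<in>V. d i j \<in> \<int>)"
proof -
  have "\<exists>f. (\<forall>j\<in>V. f j - f (nxt j) = d i j) \<and>
    ((\<forall>x\<in>V. \<forall>y\<in>V. f x - f y \<in> \<int>) \<longleftrightarrow> (\<forall>j\<in>V. d i j \<in> \<int>))" if "i \<in> V" for i
    using potential_exists[OF sum_d[OF that]] by metis
  then obtain f where f: "\<And>i j. i \<in> V \<Longrightarrow> j \<in> V \<Longrightarrow> f i j - f i (nxt j) = d i j"
    and fZ: "\<And>i. i \<in> V \<Longrightarrow> (\<forall>x\<in>V. \<forall>y\<in>V. f i x - f i y \<in> \<int>) \<longleftrightarrow> (\<forall>j\<in>V. d i j \<in> \<int>)"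
    by metis
  define v :: "nat \<Rightarrow> real ^ 'n" where
    "v i = (\<chi> j. of_int (laplacian (cycle_digraph n S) i (lab j)))" for i
  define u :: "nat \<Rightarrow> real ^ 'n" where "u i = (\<chi> j. f i (lab j))" for i
  have sum_lab: "(\<Sum>j\<in>UNIV. g (lab j)) = (\<Sum>x\<in>V. g x)" for g :: "nat \<Rightarrow> real"
    by (rule sum.reindex_bij_betw[OF lab])
  have lab_V: "lab j \<in> V" for j using lab by (auto simp: bij_betw_def)
  have uv: "u i \<bullet> v j = 1 - (if i = j then sum c V / c i else 0)" if ij: "i \<in> V" "j \<in> V" for i j
  proof -
    have "u i \<bullet> v j = (\<Sum>x\<in>V. f i x * real_of_int (laplacian (cycle_digraph n S) j x))"
      by (simp add: inner_vec_def u_def v_def flip: sum_lab)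
    also have "\<dots> = d i j - s j * d i (prv j)"
      using f[OF ij] f[OF ij(1) prv_mem[of j]] ij(2) by (simp add: sum_laplacian_row)
    finally show ?thesis using step ij by simp
  qed
  have v_H: "v i \<in> zero_sum_hyperplane" if "i \<in> V" for i
    using sum_laplacian_row[OF that, of "\<lambda>_. 1"]
    by (simp add: zero_sum_hyperplane_def v_def flip: sum_lab)
  have cv: "(\<Sum>i\<in>V. c i *\<^sub>R v i) = 0"
    using sum_laplacian_col[OF lab_V] balance[OF lab_V] by (simp add: vec_eq_iff v_def)
  interpret hyperplane_simplex V v u c
  proof
    show "card V = CARD('n)" using bij_betw_same_card[OF lab] by simp
  qed (use c_pos cv uv v_H in \<open>auto simp: integer_lattice_def v_def\<close>)
  have "laplacian_polytope lab (cycle_digraph n S) = convex hull (v ` V)"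
    by (simp add: laplacian_polytope_def v_def)
  moreover have "CARD('n) = CARD('d) + 1"
    using bij_betw_same_card[OF lab] dim by (simp add: V_def)
  ultimately have "reflexive_in TYPE('d) zero_sum_hyperplane (laplacian_polytope lab (cycle_digraph n S)) \<longleftrightarrow>
    (\<forall>i\<in>V. \<forall>a b. u i $ a - u i $ b \<in> \<int>)"
    by (simp only: reflexive_iff inner_hyperplane_lattice_iff)
  also have "\<dots> \<longleftrightarrow> (\<forall>i\<in>V. \<forall>x\<in>V. \<forall>y\<in>V. f i x - f i y \<in> \<int>)"
  proof -
    have "V = range lab" using lab by (auto simp: bij_betw_def)
    then show ?thesis by (simp add: u_def)
  qed
  finally show ?thesis using fZ by simp
qed

text \<open>All coefficients are 1. Clockwise distances from \<open>i\<close> grow by 1 at each step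
  and drop by \<open>n - 1\<close> on returning to \<open>i\<close>, as the recurrence requires;
  only their common shift can fail to be integral.\<close>

lemma reflexive_full_iff:
  fixes lab :: "'n::finite \<Rightarrow> nat"
  assumes lab: "bij_betw lab UNIV V" and dim: "CARD('d::finite) + 1 = n" and full: "S = V"
  shows "reflexive_in TYPE('d) zero_sum_hyperplane (laplacian_polytope lab (cycle_digraph n S)) \<longleftrightarrow> odd n"
proof -
  define pos where "pos i j = (THE p. p < n \<and> rot n p i = j)" for i j
  have pos_rot: "pos i (rot n p i) = p" if "p < n" for i p
    unfolding pos_def using that rot_inj by (intro the_equality) auto
  \<comment> \<open>The mean of \<open>0, ..., n - 1\<close> is subtracted, so that the differences
    sum to 0.\<close>
  define d where "d i j = real (pos i j) - (real n - 1) / 2" for i j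
  have s1: "s j = 1" if "j \<in> V" for j unfolding s_def using that full by simp
  have card_V: "card V = n" by (simp add: V_def)
  have step: "d i j - d i (prv j) = 1 - (if i = j then real n else 0)"
    if ij: "i \<in> V" "j \<in> V" for i j
  proof -
    obtain p where p: "p < n" "j = rot n p i" using ij by (rule V_rotE)
    show ?thesis
    proof (cases p)
      case 0
      then have "j = i" using p ij by simp
      moreover have "pos i i = 0" using pos_rot[OF n_pos, of i] ij by simp
      moreover have "pos i (prv i) = n - 1" unfolding prv_def using n_pos by (intro pos_rot) simp
      ultimately show ?thesis using n_pos by (simp add: d_def of_nat_diff)
    next
      case (Suc q)
      then have "i \<noteq> j" using rot_eq_self_iff[OF ij(1) p(1)] p(2) by auto
      moreover have "pos i (prv j) = q" "pos i j = p"
        using p Suc by (simp_all add: prv_rot pos_rot)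
      ultimately show ?thesis using Suc by (simp add: d_def)
    qed
  qed
  have sum_d: "(\<Sum>j\<in>V. d i j) = 0" if i: "i \<in> V" for i
  proof -
    have "inj_on (\<lambda>p. rot n p i) {..<n}" by (rule inj_onI) (simp add: rot_inj)
    moreover have "V \<subseteq> (\<lambda>p. rot n p i) ` {..<n}"
      using V_rotE[OF i] by (metis imageI lessThan_iff subsetI)
    ultimately have "bij_betw (\<lambda>p. rot n p i) {..<n} V"
      using rot_mem by (auto simp only: bij_betw_def)
    then have "(\<Sum>j\<in>V. d i j) = (\<Sum>p<n. d i (rot n p i))"
      by (rule sum.reindex_bij_betw[symmetric])
    also have "\<dots> = (\<Sum>p<n. real p - (real n - 1) / 2)"
      by (intro sum.cong) (simp_all add: d_def pos_rot)
    also have "\<dots> = (\<Sum>p<n. real p) - real n * (real n - 1) / 2" by (simp add: sum_subtractf)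
    also have "(\<Sum>p<m. real p) = real m * (real m - 1) / 2" for m
      by (induction m) (simp_all add: field_simps)
    finally show ?thesis by simp
  qed
  have "reflexive_in TYPE('d) zero_sum_hyperplane (laplacian_polytope lab (cycle_digraph n S)) \<longleftrightarrow>
    (\<forall>i\<in>V. \<forall>j\<in>V. d i j \<in> \<int>)"
    by (rule reflexive_laplacian_iff[where c = "\<lambda>_. 1", OF lab dim])
      (simp_all add: s1 step card_V sum_d)
  also have "\<dots> \<longleftrightarrow> (real n - 1) / 2 \<in> \<int>"
  proof
    assume d: "\<forall>i\<in>V. \<forall>j\<in>V. d i j \<in> \<int>"
    then have "real (pos 1 1) - d 1 1 \<in> \<int>" using n_pos by (intro Ints_diff) (auto simp: V_def)
    then show "(real n - 1) / 2 \<in> \<int>" by (simp add: d_def)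
  qed (auto simp: d_def)
  also have "\<dots> \<longleftrightarrow> odd n"
    using of_int_div_of_int_in_Ints_iff[of "int n - 1" 2, where 'a = real] by simp
  finally show ?thesis .
qed

end

lemma (in proper_cycle) reflexive_proper_iff:
  fixes lab :: "'n::finite \<Rightarrow> nat"
  assumes lab: "bij_betw lab UNIV V" and dim: "CARD('d::finite) + 1 = n"
  shows "reflexive_in TYPE('d) zero_sum_hyperplane (laplacian_polytope lab (cycle_digraph n S)) \<longleftrightarrow>
    (\<forall>i\<in>V. weight i dvd complexity (cycle_digraph n S))"
proof -
  have "sum (\<lambda>i. real (weight i)) V = real total_weight" by (simp add: total_weight_def)
  then have "reflexive_in TYPE('d) zero_sum_hyperplane (laplacian_polytope lab (cycle_digraph n S)) \<longleftrightarrow>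
    (\<forall>i\<in>V. \<forall>j\<in>V. slope i j \<in> \<int>)"
    by (intro reflexive_laplacian_iff[where c = "\<lambda>i. real (weight i)", OF lab dim])
      (simp_all add: weight_pos weight_balance slope_step sum_slope)
  then show ?thesis by (simp only: slope_Ints_iff complexity_cycle)
qed

theorem theorem18:
  fixes n r :: nat and S :: "nat set" and lab :: "'n::finite \<Rightarrow> nat"
  assumes "n \<ge> 3"
    and "S \<subseteq> {1..n}"
    and "bij_betw lab UNIV {1..n}"
    and "CARD('d::finite) + 1 = n"
    and "S \<noteq> {1..n} \<Longrightarrow> 1 \<notin> cyclic_relabel n r S"
  shows "reflexive_in TYPE('d) zero_sum_hyperplane
           (laplacian_polytope lab (cycle_digraph n S)) \<longleftrightarrow>
         S = {} \<or>
         (S = {1..n} \<and> n = 2) \<or>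
         (S = {1..n} \<and> odd n) \<or>
         ({} \<subset> S \<and> S \<subset> {1..n} \<and>
           (\<forall>k. 1 \<le> k \<and> k \<le> longest_ccw_chain n (cyclic_relabel n r S) + 1
              \<longrightarrow> k dvd complexity (cycle_digraph n S)))"
proof -
  interpret cycle n S by unfold_locales (use assms in auto)
  have lab: "bij_betw lab UNIV V" using assms(3) by (simp only: V_def)
  show ?thesis
  proof (cases "S = {1..n}")
    case True
    then show ?thesis
      using reflexive_full_iff[OF lab assms(4)] assms(1) by (auto simp: V_def)
  next
    case False
    interpret proper_cycle n S by unfold_locales (use False in \<open>simp add: V_def\<close>)
    let ?K = "longest_ccw_chain n (cyclic_relabel n r S)"
    have "(\<forall>i\<in>V. weight i dvd complexity (cycle_digraph n S)) \<longleftrightarrow>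
        (\<forall>k\<in>weight ` V. k dvd complexity (cycle_digraph n S))" by simp
    also have "\<dots> \<longleftrightarrow> (\<forall>k. 1 \<le> k \<and> k \<le> ?K + 1 \<longrightarrow> k dvd complexity (cycle_digraph n S))"
      unfolding weights_eq[OF assms(5)[OF False]] by auto
    finally have iff: "reflexive_in TYPE('d) zero_sum_hyperplane
        (laplacian_polytope lab (cycle_digraph n S)) \<longleftrightarrow>
        (\<forall>k. 1 \<le> k \<and> k \<le> ?K + 1 \<longrightarrow> k dvd complexity (cycle_digraph n S))"
      using reflexive_proper_iff[OF lab assms(4)] by simp
    show ?thesis
    proof (cases "S = {}")
      case True
      \<comment> \<open>Without backward arcs every run is empty, so each weight is 1 and divides
        everything.\<close>
      then have "weight i = 1" if "i \<in> V" for i using weight_step[OF that] by simp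
      then show ?thesis using reflexive_proper_iff[OF lab assms(4)] True by simp
    next
      case nonempty: False
      then show ?thesis using iff False assms(2) by blast
    qed
  qed
qed

end
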